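(* Let $G$ be a locally compact, non-discrete group with a fixed left Haar measure $\mu$. Then the formula $\varphi(x,y)=\|x-x*y\|=d(x,x*y)$ is unstable with respect to $\mathrm{Th}(L^1(G),* )$.
   Context: Locally compact groups are Hausdorff topological groups. For a locally compact group $G$ with left Haar measure $\mu$, $(L^1(G),* )$ denotes the real Banach lattice $L^1(G,\mu)$ equipped with convolution $(f*g)(x)=\int_G f(y)g(y^{-1}x)\,d\mu(y)$, regarded as a metric structure in continuous first-order logic in the language $\mathcal{L}_{\mathrm{cnv}}=\{+,0,\wedge,\vee,\|\cdot\|,*\}$ with metric $d(f,g)=\|f-g\|_1$; formally one works in the unit ball, treating $+,\wedge,\vee$ as maps from the unit ball to the ball of radius $2$ (or rescaling them by $1/2$). $\mathrm{Th}$ is the complete continuous theory. A formula $\varphi(x,y)$ is unstable with respect to a continuous theory $T$ if there exist a model $M$ of $T$ and sequences $(a_n)_{n<\omega},(b_m)_{m<\omega}$ from $M$ such that both iterated limits $\lim_{n}\lim_{m}\varphi(a_n,b_m)$ and $\lim_{m}\lim_{n}\varphi(a_n,b_m)$ exist and are different. *)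

theory Defs
  imports "HOL-Analysis.Analysis"
begin

section \<open>Continuous first-order logic\<close>

text \<open>
  Real-valued continuous logic for bounded metric structures. A signature fixes, besides the
  arities, a bound on the diameter, a bounded range for each predicate symbol and a modulus of
  uniform continuity for each symbol.
\<close>

record ('f, 'r) signature =
  diam_bound :: real
  fun_arity :: "'f \<Rightarrow> nat"
  fun_modulus :: "'f \<Rightarrow> real \<Rightarrow> real"
  rel_arity :: "'r \<Rightarrow> nat"
  rel_modulus :: "'r \<Rightarrow> real \<Rightarrow> real"
  rel_range :: "'r \<Rightarrow> real set"

record ('f, 'r, 'm) cstructure =
  universe :: "'m set"
  distance :: "'m \<Rightarrow> 'm \<Rightarrow> real"
  fun_interp :: "'f \<Rightarrow> 'm list \<Rightarrow> 'm"
  rel_interp :: "'r \<Rightarrow> 'm list \<Rightarrow> real"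

definition tuples :: "'m set \<Rightarrow> nat \<Rightarrow> 'm list set" where
  "tuples A n = {xs. length xs = n \<and> set xs \<subseteq> A}"

definition metric_structure :: "('f, 'r) signature \<Rightarrow> ('f, 'r, 'm) cstructure \<Rightarrow> bool" where
  "metric_structure L M \<longleftrightarrow>
     universe M \<noteq> {} \<and>
     Metric_space (universe M) (distance M) \<and>
     Metric_space.mcomplete (universe M) (distance M) \<and>
     (\<forall>x\<in>universe M. \<forall>y\<in>universe M. distance M x y \<le> diam_bound L) \<and>
     (\<forall>f. \<forall>xs\<in>tuples (universe M) (fun_arity L f). fun_interp M f xs \<in> universe M) \<and>
     (\<forall>f. \<forall>xs\<in>tuples (universe M) (fun_arity L f). \<forall>ys\<in>tuples (universe M) (fun_arity L f).
        \<forall>\<epsilon>>0. (\<forall>i<fun_arity L f. distance M (xs ! i) (ys ! i) < fun_modulus L f \<epsilon>) \<longrightarrow>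
          distance M (fun_interp M f xs) (fun_interp M f ys) \<le> \<epsilon>) \<and>
     (\<forall>r. \<forall>xs\<in>tuples (universe M) (rel_arity L r). rel_interp M r xs \<in> rel_range L r) \<and>
     (\<forall>r. \<forall>xs\<in>tuples (universe M) (rel_arity L r). \<forall>ys\<in>tuples (universe M) (rel_arity L r).
        \<forall>\<epsilon>>0. (\<forall>i<rel_arity L r. distance M (xs ! i) (ys ! i) < rel_modulus L r \<epsilon>) \<longrightarrow>
          \<bar>rel_interp M r xs - rel_interp M r ys\<bar> \<le> \<epsilon>)"

datatype 'f cterm = Var nat | Fn 'f "'f cterm list"

text \<open>
  \<open>Conn u [\<phi>\<^sub>0, \<dots>, \<phi>\<^sub>k]\<close> applies a continuous connective. The \<open>(k+1)\<close>-ary continuous functions are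
  represented by functions of a sequence, continuous for the product topology and evaluated at
  sequences padded with \<open>0\<close>.
\<close>

datatype ('f, 'r) cformula =
    Dist "'f cterm" "'f cterm"
  | Rel 'r "'f cterm list"
  | Conn "(nat \<Rightarrow> real) \<Rightarrow> real" "('f, 'r) cformula list"
  | SupQ nat "('f, 'r) cformula"
  | InfQ nat "('f, 'r) cformula"

fun wf_cterm :: "('f, 'r) signature \<Rightarrow> 'f cterm \<Rightarrow> bool" where
  "wf_cterm L (Var i) \<longleftrightarrow> True"
| "wf_cterm L (Fn f ts) \<longleftrightarrow> length ts = fun_arity L f \<and> (\<forall>t\<in>set ts. wf_cterm L t)"

fun wf_cformula :: "('f, 'r) signature \<Rightarrow> ('f, 'r) cformula \<Rightarrow> bool" where
  "wf_cformula L (Dist s t) \<longleftrightarrow> wf_cterm L s \<and> wf_cterm L t"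
| "wf_cformula L (Rel r ts) \<longleftrightarrow> length ts = rel_arity L r \<and> (\<forall>t\<in>set ts. wf_cterm L t)"
| "wf_cformula L (Conn u \<phi>s) \<longleftrightarrow> continuous_on UNIV u \<and> (\<forall>\<phi>\<in>set \<phi>s. wf_cformula L \<phi>)"
| "wf_cformula L (SupQ i \<phi>) \<longleftrightarrow> wf_cformula L \<phi>"
| "wf_cformula L (InfQ i \<phi>) \<longleftrightarrow> wf_cformula L \<phi>"

fun cterm_vars :: "'f cterm \<Rightarrow> nat set" where
  "cterm_vars (Var i) = {i}"
| "cterm_vars (Fn f ts) = (\<Union>t\<in>set ts. cterm_vars t)"

fun free_vars :: "('f, 'r) cformula \<Rightarrow> nat set" where
  "free_vars (Dist s t) = cterm_vars s \<union> cterm_vars t"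
| "free_vars (Rel r ts) = (\<Union>t\<in>set ts. cterm_vars t)"
| "free_vars (Conn u \<phi>s) = (\<Union>\<phi>\<in>set \<phi>s. free_vars \<phi>)"
| "free_vars (SupQ i \<phi>) = free_vars \<phi> - {i}"
| "free_vars (InfQ i \<phi>) = free_vars \<phi> - {i}"

fun eval_cterm :: "('f, 'r, 'm) cstructure \<Rightarrow> (nat \<Rightarrow> 'm) \<Rightarrow> 'f cterm \<Rightarrow> 'm" where
  "eval_cterm M \<sigma> (Var i) = \<sigma> i"
| "eval_cterm M \<sigma> (Fn f ts) = fun_interp M f (map (eval_cterm M \<sigma>) ts)"

fun eval :: "('f, 'r, 'm) cstructure \<Rightarrow> (nat \<Rightarrow> 'm) \<Rightarrow> ('f, 'r) cformula \<Rightarrow> real" where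
  "eval M \<sigma> (Dist s t) = distance M (eval_cterm M \<sigma> s) (eval_cterm M \<sigma> t)"
| "eval M \<sigma> (Rel r ts) = rel_interp M r (map (eval_cterm M \<sigma>) ts)"
| "eval M \<sigma> (Conn u \<phi>s) =
     u (\<lambda>i. if i < length \<phi>s then map (eval M \<sigma>) \<phi>s ! i else 0)"
| "eval M \<sigma> (SupQ i \<phi>) = (SUP a\<in>universe M. eval M (\<sigma>(i := a)) \<phi>)"
| "eval M \<sigma> (InfQ i \<phi>) = (INF a\<in>universe M. eval M (\<sigma>(i := a)) \<phi>)"

definition sentence :: "('f, 'r) signature \<Rightarrow> ('f, 'r) cformula \<Rightarrow> bool" where
  "sentence L \<phi> \<longleftrightarrow> wf_cformula L \<phi> \<and> free_vars \<phi> = {}"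

text \<open>A theory is a set of sentences, each \<open>\<phi>\<close> standing for the condition \<open>\<phi> = 0\<close>.\<close>

definition satisfies :: "('f, 'r, 'm) cstructure \<Rightarrow> ('f, 'r) cformula \<Rightarrow> bool" where
  "satisfies M \<phi> \<longleftrightarrow> (\<forall>\<sigma>. range \<sigma> \<subseteq> universe M \<longrightarrow> eval M \<sigma> \<phi> = 0)"

definition Th :: "('f, 'r) signature \<Rightarrow> ('f, 'r, 'm) cstructure \<Rightarrow> ('f, 'r) cformula set" where
  "Th L M = {\<phi>. sentence L \<phi> \<and> satisfies M \<phi>}"

definition is_model ::
    "('f, 'r) signature \<Rightarrow> ('f, 'r) cformula set \<Rightarrow> ('f, 'r, 'm) cstructure \<Rightarrow> bool" where
  "is_model L T M \<longleftrightarrow> metric_structure L M \<and> (\<forall>\<phi>\<in>T. satisfies M \<phi>)"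

text \<open>
  Instability of \<open>\<phi>(x, y)\<close>, where \<open>x\<close> and \<open>y\<close> are the indices of two distinct variables containing
  the free variables of \<open>\<phi>\<close>. The type argument is the type in which the universe of the model
  lives. By the downward Loewenheim-Skolem theorem, for a countable signature the notion does not
  depend on it as long as it has at least continuum many elements.
\<close>

definition unstable ::
    "'m itself \<Rightarrow> ('f, 'r) signature \<Rightarrow> ('f, 'r) cformula set \<Rightarrow>
       nat \<Rightarrow> nat \<Rightarrow> ('f, 'r) cformula \<Rightarrow> bool" where
  "unstable _ L T x y \<phi> \<longleftrightarrow>
     (\<exists>(M :: ('f, 'r, 'm) cstructure) a b. is_model L T M \<and>
        range a \<subseteq> universe M \<and> range b \<subseteq> universe M \<and>
        (let v = (\<lambda>n m. eval M ((\<lambda>_. undefined)(x := a n, y := b m)) \<phi>) in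
          \<exists>(f :: nat \<Rightarrow> real) (g :: nat \<Rightarrow> real) k l.
            (\<forall>n. (\<lambda>m. v n m) \<longlonglongrightarrow> f n) \<and> f \<longlonglongrightarrow> k \<and>
            (\<forall>m. (\<lambda>n. v n m) \<longlonglongrightarrow> g m) \<and> g \<longlonglongrightarrow> l \<and>
            k \<noteq> l))"


section \<open>The convolution lattice of a locally compact group\<close>

text \<open>
  Groups are written additively, but \<open>topological_group_add\<close> does not assume commutativity; so
  \<open>- y + x\<close> below is what is written multiplicatively as the inverse of \<open>y\<close> times \<open>x\<close>.
\<close>

definition left_haar_measure :: "'a::{topological_group_add, t2_space} measure \<Rightarrow> bool" where
  "left_haar_measure \<mu> \<longleftrightarrow>
     sets \<mu> = sets borel \<and>
     emeasure \<mu> (space \<mu>) \<noteq> 0 \<and>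
     (\<forall>K. compact K \<longrightarrow> emeasure \<mu> K < \<infinity>) \<and>
     (\<forall>A\<in>sets borel. emeasure \<mu> A = (INF U\<in>{U. open U \<and> A \<subseteq> U}. emeasure \<mu> U)) \<and>
     (\<forall>U. open U \<longrightarrow> emeasure \<mu> U = (SUP K\<in>{K. compact K \<and> K \<subseteq> U}. emeasure \<mu> K)) \<and>
     (\<forall>g. \<forall>A\<in>sets borel. emeasure \<mu> ((\<lambda>x. g + x) ` A) = emeasure \<mu> A)"

definition L1_class :: "'a measure \<Rightarrow> ('a \<Rightarrow> real) \<Rightarrow> ('a \<Rightarrow> real) set" where
  "L1_class \<mu> f = {h. integrable \<mu> h \<and> (AE x in \<mu>. h x = f x)}"

definition L1_space :: "'a measure \<Rightarrow> ('a \<Rightarrow> real) set set" where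
  "L1_space \<mu> = L1_class \<mu> ` {f. integrable \<mu> f}"

definition L1_rep :: "('a \<Rightarrow> real) set \<Rightarrow> 'a \<Rightarrow> real" where
  "L1_rep F = (SOME f. f \<in> F)"

definition L1_norm :: "'a measure \<Rightarrow> ('a \<Rightarrow> real) set \<Rightarrow> real" where
  "L1_norm \<mu> F = (\<integral>x. \<bar>L1_rep F x\<bar> \<partial>\<mu>)"

definition L1_dist :: "'a measure \<Rightarrow> ('a \<Rightarrow> real) set \<Rightarrow> ('a \<Rightarrow> real) set \<Rightarrow> real" where
  "L1_dist \<mu> F G = (\<integral>x. \<bar>L1_rep F x - L1_rep G x\<bar> \<partial>\<mu>)"

definition group_convolution ::
    "'a::topological_group_add measure \<Rightarrow> ('a \<Rightarrow> real) \<Rightarrow> ('a \<Rightarrow> real) \<Rightarrow> 'a \<Rightarrow> real" where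
  "group_convolution \<mu> f g x = (\<integral>y. f y * g (- y + x) \<partial>\<mu>)"

definition L1_lift2 ::
    "'a measure \<Rightarrow> (('a \<Rightarrow> real) \<Rightarrow> ('a \<Rightarrow> real) \<Rightarrow> 'a \<Rightarrow> real) \<Rightarrow>
       ('a \<Rightarrow> real) set \<Rightarrow> ('a \<Rightarrow> real) set \<Rightarrow> ('a \<Rightarrow> real) set" where
  "L1_lift2 \<mu> p F G = L1_class \<mu> (p (L1_rep F) (L1_rep G))"

datatype cnv_fun = Plus | Zero | Meet | Join | Convol

datatype cnv_rel = Norm

text \<open>
  The structures are unit balls, on which \<open>Plus\<close>, \<open>Meet\<close> and \<open>Join\<close> denote the Banach lattice operations
  rescaled by \<open>1/2\<close>. With this rescaling they are 1-Lipschitz for the maximum metric on pairs,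
  whereas convolution is 2-Lipschitz.
\<close>

definition L_cnv :: "(cnv_fun, cnv_rel) signature" where
  "L_cnv = \<lparr>diam_bound = 2,
     fun_arity = (\<lambda>f. if f = Zero then 0 else 2),
     fun_modulus = (\<lambda>f \<epsilon>. if f = Convol then \<epsilon> / 2 else \<epsilon>),
     rel_arity = (\<lambda>_. 1),
     rel_modulus = (\<lambda>_ \<epsilon>. \<epsilon>),
     rel_range = (\<lambda>_. {0..1})\<rparr>"

definition L1_structure ::
    "'a::topological_group_add measure \<Rightarrow> (cnv_fun, cnv_rel, ('a \<Rightarrow> real) set) cstructure" where
  "L1_structure \<mu> = \<lparr>universe = {F \<in> L1_space \<mu>. L1_norm \<mu> F \<le> 1},
     distance = L1_dist \<mu>,
     fun_interp = (\<lambda>s Fs. case s of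
         Plus \<Rightarrow> L1_lift2 \<mu> (\<lambda>f g x. (f x + g x) / 2) (Fs ! 0) (Fs ! 1)
       | Zero \<Rightarrow> L1_class \<mu> (\<lambda>_. 0)
       | Meet \<Rightarrow> L1_lift2 \<mu> (\<lambda>f g x. min (f x) (g x) / 2) (Fs ! 0) (Fs ! 1)
       | Join \<Rightarrow> L1_lift2 \<mu> (\<lambda>f g x. max (f x) (g x) / 2) (Fs ! 0) (Fs ! 1)
       | Convol \<Rightarrow> L1_lift2 \<mu> (group_convolution \<mu>) (Fs ! 0) (Fs ! 1)),
     rel_interp = (\<lambda>_ Fs. L1_norm \<mu> (Fs ! 0))\<rparr>"

end

theory Submission
  imports Defs "HOL-Probability.Giry_Monad"
begin

text \<open>
  The structure \<open>L\<^sup>1(G)\<close> itself carries the witnesses. For a set \<open>A\<close> of positive finite measure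
  let \<open>1\<^sub>A / \<mu> A\<close> be its normalised indicator. Since \<open>G\<close> is not discrete, points are null, so
  there are compact sets \<open>V n\<close> with \<open>0 < \<mu> (V n) \<longlonglongrightarrow> 0\<close>; let \<open>a n\<close> be their normalised indicators,
  and let \<open>b m\<close> be those of symmetric open neighbourhoods \<open>U m\<close> of the identity. The functions
  \<open>a n\<close> and \<open>a n * b m\<close> are probability densities and \<open>a n * b m\<close> is bounded both by \<open>1 / \<mu> (V n)\<close>
  and by \<open>1 / \<mu> (U m)\<close>. As \<open>a n * b m\<close> is supported in the sum set of \<open>V n\<close> and \<open>U m\<close>, the first
  bound shows that their distance is at most \<open>2 \<mu> ((V n + U m) - V n) / \<mu> (V n)\<close>, which by outer
  regularity is small for \<open>n \<le> m\<close> if \<open>U m\<close> is small. By the second bound the distance is at least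
  \<open>2 (1 - \<mu> (V n) / \<mu> (U m))\<close>, which tends to \<open>2\<close> as \<open>n\<close> grows. The iterated limits are therefore
  \<open>0\<close> and \<open>2\<close>.
\<close>

subsection \<open>Tonelli's theorem for Radon probability measures\<close>

text \<open>
  When the spaces are not second countable, the Borel sets of a product are in general not in the
  product sigma algebra, so Tonelli's theorem of the library does not cover functions such as
  \<open>(x, y) \<mapsto> f y * g (- y + x)\<close>. For inner regular measures the tube lemma makes the section measures
  of an open set lower semicontinuous; and up to null sections, an open set is a countable union of
  sets \<open>A \<times> K\<close> with \<open>A\<close> open and \<open>K\<close> compact, to which the theorem of the library applies.
\<close>

lemma measurable_Pair_right_borel: "Pair x \<in> borel \<rightarrow>\<^sub>M borel"
  by (intro borel_measurable_continuous_onI continuous_intros)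

lemma measurable_swap_borel: "prod.swap \<in> borel \<rightarrow>\<^sub>M borel"
  by (intro borel_measurable_continuous_onI continuous_on_swap)

lemma open_Pair_vimage: "open W \<Longrightarrow> open (Pair x -` W)"
  by (intro open_vimage continuous_intros)

locale inner_regular_measure =
  fixes M :: "'a::t2_space measure"
  assumes sets_borel [measurable_cong]: "sets M = sets borel"
    and emeasure_open_eq_SUP_compact:
      "open U \<Longrightarrow> emeasure M U = (SUP K\<in>{K. compact K \<and> K \<subseteq> U}. emeasure M K)"
begin

lemma space_UNIV [simp]: "space M = UNIV"
  using sets_eq_imp_space_eq[OF sets_borel] by simp

lemma measurable_borel: "borel_measurable M = borel_measurable borel"
  by (intro measurable_cong_sets sets_borel refl)

lemma open_sets [intro]: "open U \<Longrightarrow> U \<in> sets M"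
  by (simp add: sets_borel)

lemma compact_sets [intro]: "compact K \<Longrightarrow> K \<in> sets M"
  by (simp add: sets_borel borel_compact)

lemma ex_compact_subset_emeasure_gt:
  assumes "open U" "t < emeasure M U"
  obtains K where "compact K" "K \<subseteq> U" "t < emeasure M K"
  using assms that by (auto simp: emeasure_open_eq_SUP_compact less_SUP_iff)

lemma ex_compact_sequence_emeasure_SUP:
  assumes "open U"
  obtains K :: "nat \<Rightarrow> 'a set" where "\<And>n. compact (K n)" "\<And>n. K n \<subseteq> U"
    "emeasure M U = (SUP n. emeasure M (K n))"
proof -
  have "{K. compact K \<and> K \<subseteq> U} \<noteq> {}" by (auto intro: exI[of _ "{}"])
  from ennreal_SUP_countable_SUP[OF this, of "emeasure M"] obtain s :: "nat \<Rightarrow> ennreal" where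
    s: "range s \<subseteq> emeasure M ` {K. compact K \<and> K \<subseteq> U}" "emeasure M U = (SUP n. s n)"
    unfolding emeasure_open_eq_SUP_compact[OF assms] by blast
  then have "\<forall>n. \<exists>K. compact K \<and> K \<subseteq> U \<and> s n = emeasure M K" by blast
  from choice[OF this] obtain K where "\<forall>n. compact (K n) \<and> K n \<subseteq> U \<and> s n = emeasure M (K n)" ..
  with s(2) that[of K] show thesis by simp
qed

lemma ex_open_Times_compact:
  assumes W: "open W" and t: "t < emeasure M (Pair x -` W)"
  obtains A K where "open A" "compact K" "x \<in> A" "A \<times> K \<subseteq> W" "t < emeasure M K"
proof -
  obtain K where K: "compact K" "K \<subseteq> Pair x -` W" "t < emeasure M K"
    using ex_compact_subset_emeasure_gt[OF open_Pair_vimage[OF W] t] .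
  then have "{x} \<times> K \<subseteq> W" by auto
  then obtain A where "x \<in> A" "open A" "A \<times> K \<subseteq> W"
    using Elementary_Topology.tube_lemma[OF K(1) W, of x] by blast
  with K that show thesis by blast
qed

lemma open_emeasure_section_gt:
  assumes W: "open W"
  shows "open {x. t < emeasure M (Pair x -` W)}"
proof (subst open_subopen, intro ballI)
  fix x assume "x \<in> {x. t < emeasure M (Pair x -` W)}"
  then have "t < emeasure M (Pair x -` W)" by simp
  then obtain A K where A: "open A" "x \<in> A" "A \<times> K \<subseteq> W" and K: "t < emeasure M K"
    by (rule ex_open_Times_compact[OF W])
  have "emeasure M K \<le> emeasure M (Pair x' -` W)" if "x' \<in> A" for x'
    using A(3) that by (intro emeasure_mono open_sets open_Pair_vimage W) auto
  with A K show "\<exists>T. open T \<and> x \<in> T \<and> T \<subseteq> {x. t < emeasure M (Pair x -` W)}"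
    by (intro exI[of _ A]) (auto intro: less_le_trans)
qed

lemma measurable_emeasure_section_open:
  "open W \<Longrightarrow> (\<lambda>x. emeasure M (Pair x -` W)) \<in> borel_measurable borel"
  by (intro borel_measurableI_greater) (simp add: open_emeasure_section_gt)

end

locale radon_prob_space = inner_regular_measure M + prob_space M
  for M :: "'a::t2_space measure"
begin

lemma ex_countable_subcover_AE:
  assumes \<U>: "\<And>U. U \<in> \<U> \<Longrightarrow> open U"
  obtains \<C> where "\<C> \<subseteq> \<U>" "countable \<C>" "AE x in M. x \<in> \<Union>\<U> \<longrightarrow> x \<in> \<Union>\<C>"
proof -
  obtain K :: "nat \<Rightarrow> 'a set" where K: "\<And>n. compact (K n)" "\<And>n. K n \<subseteq> \<Union>\<U>"
      "emeasure M (\<Union>\<U>) = (SUP n. emeasure M (K n))"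
    using ex_compact_sequence_emeasure_SUP[of "\<Union>\<U>"] \<U> by auto
  have "\<exists>\<F>\<subseteq>\<U>. finite \<F> \<and> K n \<subseteq> \<Union>\<F>" for n
    by (rule compactE[OF K(1) K(2) \<U>]) auto
  then obtain \<F> where \<F>: "\<And>n. \<F> n \<subseteq> \<U>" "\<And>n. finite (\<F> n)" "\<And>n. K n \<subseteq> \<Union>(\<F> n)"
    by metis
  define \<C> where "\<C> = (\<Union>n. \<F> n)"
  have "\<C> \<subseteq> \<U>" unfolding \<C>_def using \<F>(1) by blast
  have "countable \<C>"
    unfolding \<C>_def using \<F>(2) by (intro countable_UN) (auto intro: countable_finite)
  have sets_Union: "\<Union>\<U> \<in> sets M" "\<Union>\<C> \<in> sets M"
    using \<U> \<open>\<C> \<subseteq> \<U>\<close> by (auto intro!: open_sets)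
  have "emeasure M (\<Union>\<U>) \<le> emeasure M (\<Union>\<C>)"
    unfolding K(3) \<C>_def using \<F>(3)
    by (intro SUP_least emeasure_mono sets_Union[unfolded \<C>_def]) blast
  then have "emeasure M (\<Union>\<U> - \<Union>\<C>) = 0"
    using \<open>\<C> \<subseteq> \<U>\<close> sets_Union
    by (subst emeasure_Diff) (auto simp: diff_eq_0_iff_ennreal less_top[symmetric])
  then have "AE x in M. x \<notin> \<Union>\<U> - \<Union>\<C>"
    using sets_Union by (intro AE_not_in null_setsI) auto
  then have "AE x in M. x \<in> \<Union>\<U> \<longrightarrow> x \<in> \<Union>\<C>"
    by eventually_elim auto
  with \<open>\<C> \<subseteq> \<U>\<close> \<open>countable \<C>\<close> that show thesis by blast
qed

lemma measurable_Pair: "Pair x \<in> M \<rightarrow>\<^sub>M borel"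
  using measurable_Pair_right_borel by (simp add: sets_borel cong: measurable_cong_sets)

lemma emeasure_distr_Pair:
  "E \<in> sets borel \<Longrightarrow> emeasure (distr M borel (Pair x)) E = emeasure M (Pair x -` E)"
  by (simp add: emeasure_distr[OF measurable_Pair])

lemma measurable_distr_Pair_borel:
  "(\<lambda>x. distr M borel (Pair x)) \<in> borel \<rightarrow>\<^sub>M
    subprob_algebra (borel :: ('b::topological_space \<times> 'a) measure)"
proof (rule measurable_subprob_algebra_generated)
  show "sets (borel :: ('b \<times> 'a) measure) = sigma_sets UNIV {W. open W}"
    by (simp add: borel_def)
  show "subprob_space (distr M (borel :: ('b \<times> 'a) measure) (Pair x))" for x
    by (intro prob_space_imp_subprob_space prob_space_distr measurable_Pair)
  show "(\<lambda>x. emeasure (distr M borel (Pair x)) W) \<in> borel_measurable borel"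
    if "W \<in> {W. open W}" for W :: "('b \<times> 'a) set"
    using that measurable_emeasure_section_open[of W] by (simp add: emeasure_distr_Pair)
  then show "(\<lambda>x. emeasure (distr M borel (Pair x)) (UNIV :: ('b \<times> 'a) set))
      \<in> borel_measurable borel"
    by simp
qed (auto simp: Int_stable_def)

lemma nn_integral_distr_Pair:
  "F \<in> borel_measurable borel \<Longrightarrow> (\<integral>\<^sup>+p. F p \<partial>distr M borel (Pair x)) = (\<integral>\<^sup>+y. F (x, y) \<partial>M)"
  by (simp add: nn_integral_distr[OF measurable_Pair])

lemma measurable_nn_integral_section:
  fixes F :: "'b::topological_space \<times> 'a \<Rightarrow> ennreal"
  assumes "F \<in> borel_measurable borel"
  shows "(\<lambda>x. \<integral>\<^sup>+y. F (x, y) \<partial>M) \<in> borel_measurable borel"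
  using measurable_compose[OF measurable_distr_Pair_borel
      nn_integral_measurable_subprob_algebra[OF assms]]
  by (simp add: nn_integral_distr_Pair[OF assms])

end

definition radon_product ::
    "'a::topological_space measure \<Rightarrow> 'b::topological_space measure \<Rightarrow> ('a \<times> 'b) measure" where
  "radon_product \<kappa> \<nu> = \<kappa> \<bind> (\<lambda>x. distr \<nu> borel (Pair x))"

locale radon_prob_pair = \<kappa>: radon_prob_space \<kappa> + \<nu>: radon_prob_space \<nu>
  for \<kappa> :: "'a::t2_space measure" and \<nu> :: "'b::t2_space measure"
begin

lemma ex_pair_measurable_section_gt:
  assumes W: "open W"
  obtains R where "R \<in> sets (\<kappa> \<Otimes>\<^sub>M \<nu>)" "R \<subseteq> W"
    "AE x in \<kappa>. t < emeasure \<nu> (Pair x -` W) \<longrightarrow> t < emeasure \<nu> (Pair x -` R)"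
proof -
  define \<U> where "\<U> = {A. open A \<and> (\<exists>K. compact K \<and> A \<times> K \<subseteq> W \<and> t < emeasure \<nu> K)}"
  obtain \<C> where \<C>: "\<C> \<subseteq> \<U>" "countable \<C>" "AE x in \<kappa>. x \<in> \<Union>\<U> \<longrightarrow> x \<in> \<Union>\<C>"
    by (rule \<kappa>.ex_countable_subcover_AE[of \<U>]) (auto simp: \<U>_def)
  have "\<exists>K. compact K \<and> A \<times> K \<subseteq> W \<and> t < emeasure \<nu> K" if "A \<in> \<C>" for A
    using that \<C>(1) by (auto simp: \<U>_def)
  then obtain K where K: "\<And>A. A \<in> \<C> \<Longrightarrow> compact (K A)" "\<And>A. A \<in> \<C> \<Longrightarrow> A \<times> K A \<subseteq> W"
      "\<And>A. A \<in> \<C> \<Longrightarrow> t < emeasure \<nu> (K A)"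
    by metis
  define R where "R = (\<Union>A\<in>\<C>. A \<times> K A)"
  have R: "R \<in> sets (\<kappa> \<Otimes>\<^sub>M \<nu>)"
    unfolding R_def using \<C> K
    by (intro sets.countable_UN'' pair_measureI) (auto simp: \<U>_def)
  moreover have "R \<subseteq> W" unfolding R_def using K(2) by blast
  moreover have "AE x in \<kappa>. t < emeasure \<nu> (Pair x -` W) \<longrightarrow> t < emeasure \<nu> (Pair x -` R)"
    using \<C>(3)
  proof eventually_elim
    case (elim x)
    show ?case
    proof
      assume "t < emeasure \<nu> (Pair x -` W)"
      then obtain B L where "open B" "compact L" "x \<in> B" "B \<times> L \<subseteq> W" "t < emeasure \<nu> L"
        by (rule \<nu>.ex_open_Times_compact[OF W])
      then have "x \<in> \<Union>\<U>" unfolding \<U>_def by blast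
      with elim obtain A where A: "A \<in> \<C>" "x \<in> A" by blast
      then have "emeasure \<nu> (K A) \<le> emeasure \<nu> (Pair x -` R)"
        using sets_Pair1[OF R] by (intro emeasure_mono) (auto simp: R_def)
      with K(3)[OF A(1)] show "t < emeasure \<nu> (Pair x -` R)" by (rule less_le_trans)
    qed
  qed
  ultimately show thesis by (rule that)
qed

lemma ex_pair_measurable_section_eq:
  assumes W: "open W"
  obtains R where "R \<in> sets (\<kappa> \<Otimes>\<^sub>M \<nu>)" "R \<subseteq> W"
    "AE x in \<kappa>. emeasure \<nu> (Pair x -` W) = emeasure \<nu> (Pair x -` R)"
proof -
  let ?e = "\<lambda>t. ennreal (real_of_rat t)"
  have "\<forall>t. \<exists>R. R \<in> sets (\<kappa> \<Otimes>\<^sub>M \<nu>) \<and> R \<subseteq> W \<and>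
      (AE x in \<kappa>. ?e t < emeasure \<nu> (Pair x -` W) \<longrightarrow> ?e t < emeasure \<nu> (Pair x -` R))"
    by (rule allI, rule ex_pair_measurable_section_gt[OF W]) blast
  from choice[OF this] obtain R where R: "\<And>t. R t \<in> sets (\<kappa> \<Otimes>\<^sub>M \<nu>)" "\<And>t. R t \<subseteq> W"
      "\<And>t. AE x in \<kappa>. ?e t < emeasure \<nu> (Pair x -` W) \<longrightarrow> ?e t < emeasure \<nu> (Pair x -` R t)"
    by blast
  have UR: "(\<Union>t. R t) \<in> sets (\<kappa> \<Otimes>\<^sub>M \<nu>)" "(\<Union>t. R t) \<subseteq> W"
    using R(1,2) by auto
  have "AE x in \<kappa>. \<forall>t. ?e t < emeasure \<nu> (Pair x -` W) \<longrightarrow> ?e t < emeasure \<nu> (Pair x -` R t)"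
    unfolding AE_all_countable using R(3) by blast
  then have "AE x in \<kappa>. emeasure \<nu> (Pair x -` W) = emeasure \<nu> (Pair x -` (\<Union>t. R t))"
  proof eventually_elim
    case (elim x)
    have mono: "emeasure \<nu> (Pair x -` R t) \<le> emeasure \<nu> (Pair x -` (\<Union>t. R t))" for t
      using sets_Pair1[OF UR(1)] by (intro emeasure_mono) auto
    show ?case
    proof (rule antisym)
      show "emeasure \<nu> (Pair x -` W) \<le> emeasure \<nu> (Pair x -` (\<Union>t. R t))"
      proof (rule ccontr)
        assume "\<not> ?thesis"
        then obtain t where t: "emeasure \<nu> (Pair x -` (\<Union>t. R t)) < ?e t"
            "?e t < emeasure \<nu> (Pair x -` W)"
          using ennreal_rat_dense by (auto simp: not_le)
        with elim have "?e t < emeasure \<nu> (Pair x -` R t)" by simp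
        with mono[of t] t(1) show False by simp
      qed
      show "emeasure \<nu> (Pair x -` (\<Union>t. R t)) \<le> emeasure \<nu> (Pair x -` W)"
        using UR(2) by (intro emeasure_mono \<nu>.open_sets open_Pair_vimage W) auto
    qed
  qed
  with UR that show thesis by blast
qed

lemma measurable_distr_Pair:
  "(\<lambda>x. distr \<nu> borel (Pair x)) \<in> \<kappa> \<rightarrow>\<^sub>M subprob_algebra borel"
  using \<nu>.measurable_distr_Pair_borel by (simp add: \<kappa>.sets_borel cong: measurable_cong_sets)

lemma sets_radon_product: "sets (radon_product \<kappa> \<nu>) = sets borel"
  unfolding radon_product_def by (rule sets_bind) auto

lemma measurable_swap_radon_product: "prod.swap \<in> radon_product \<kappa> \<nu> \<rightarrow>\<^sub>M borel"
  using measurable_swap_borel by (simp add: sets_radon_product cong: measurable_cong_sets)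

lemma nn_integral_radon_product:
  assumes "F \<in> borel_measurable borel"
  shows "(\<integral>\<^sup>+p. F p \<partial>radon_product \<kappa> \<nu>) = (\<integral>\<^sup>+x. \<integral>\<^sup>+y. F (x, y) \<partial>\<nu> \<partial>\<kappa>)"
  unfolding radon_product_def
  by (simp add: nn_integral_bind[OF assms measurable_distr_Pair] \<nu>.nn_integral_distr_Pair[OF assms])

lemma emeasure_radon_product:
  assumes "E \<in> sets borel"
  shows "emeasure (radon_product \<kappa> \<nu>) E = (\<integral>\<^sup>+x. emeasure \<nu> (Pair x -` E) \<partial>\<kappa>)"
  unfolding radon_product_def
  by (simp add: emeasure_bind[OF _ measurable_distr_Pair assms] \<nu>.emeasure_distr_Pair[OF assms])

lemma emeasure_radon_product_open_le:
  assumes W: "open W"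
  shows "emeasure (radon_product \<kappa> \<nu>) W \<le> emeasure (radon_product \<nu> \<kappa>) (prod.swap -` W)"
proof -
  interpret swap: radon_prob_pair \<nu> \<kappa> ..
  interpret pair_sigma_finite \<kappa> \<nu> ..
  obtain R where R: "R \<in> sets (\<kappa> \<Otimes>\<^sub>M \<nu>)" "R \<subseteq> W"
      "AE x in \<kappa>. emeasure \<nu> (Pair x -` W) = emeasure \<nu> (Pair x -` R)"
    by (rule ex_pair_measurable_section_eq[OF W])
  have W': "open (prod.swap -` W)"
    by (intro open_vimage continuous_on_swap W)
  have "emeasure (radon_product \<kappa> \<nu>) W = (\<integral>\<^sup>+x. emeasure \<nu> (Pair x -` R) \<partial>\<kappa>)"
    using R(3) W by (simp add: emeasure_radon_product nn_integral_cong_AE)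
  also have "\<dots> = emeasure (\<kappa> \<Otimes>\<^sub>M \<nu>) R"
    by (rule \<nu>.emeasure_pair_measure_alt[OF R(1), symmetric])
  also have "\<dots> = (\<integral>\<^sup>+y. emeasure \<kappa> ((\<lambda>x. (x, y)) -` R) \<partial>\<nu>)"
    by (rule emeasure_pair_measure_alt2[OF R(1)])
  also have "\<dots> \<le> (\<integral>\<^sup>+y. emeasure \<kappa> (Pair y -` (prod.swap -` W)) \<partial>\<nu>)"
    using R(2) by (intro nn_integral_mono emeasure_mono \<kappa>.open_sets open_Pair_vimage W') auto
  also have "\<dots> = emeasure (radon_product \<nu> \<kappa>) (prod.swap -` W)"
    using W' by (simp add: swap.emeasure_radon_product)
  finally show ?thesis .
qed

lemma radon_product_swap:
  "distr (radon_product \<nu> \<kappa>) borel prod.swap = radon_product \<kappa> \<nu>"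
proof (rule measure_eqI_generator_eq)
  interpret swap: radon_prob_pair \<nu> \<kappa> ..
  have emeasure_distr_swap: "emeasure (distr (radon_product \<nu> \<kappa>) borel prod.swap) W
      = emeasure (radon_product \<nu> \<kappa>) (prod.swap -` W)" if "open W" for W
    using that swap.sets_radon_product[THEN sets_eq_imp_space_eq]
    by (simp add: emeasure_distr[OF swap.measurable_swap_radon_product])
  show "emeasure (distr (radon_product \<nu> \<kappa>) borel prod.swap) W = emeasure (radon_product \<kappa> \<nu>) W"
    if "W \<in> {W. open W}" for W
  proof -
    from that have W: "open W" by simp
    have "open (prod.swap -` W)" by (intro open_vimage continuous_on_swap W)
    moreover have "prod.swap -` (prod.swap -` W) = W" by auto
    ultimately show ?thesis
      using emeasure_radon_product_open_le[OF W]
        swap.emeasure_radon_product_open_le[of "prod.swap -` W"]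
      by (simp add: emeasure_distr_swap[OF W])
  qed
  show "sets (distr (radon_product \<nu> \<kappa>) borel prod.swap) = sigma_sets UNIV {W. open W}"
    "sets (radon_product \<kappa> \<nu>) = sigma_sets UNIV {W. open W}"
    by (simp_all add: sets_radon_product) (simp_all add: borel_def)
  show "range (\<lambda>_::nat. UNIV) \<subseteq> {W :: ('a \<times> 'b) set. open W}" by auto
  show "emeasure (distr (radon_product \<nu> \<kappa>) borel prod.swap) UNIV \<noteq> \<infinity>"
    using \<nu>.emeasure_space_1 \<kappa>.emeasure_space_1
    by (simp add: emeasure_distr_swap swap.emeasure_radon_product)
qed (auto simp: Int_stable_def)

theorem tonelli_radon:
  assumes F: "F \<in> borel_measurable borel"
  shows "(\<integral>\<^sup>+x. \<integral>\<^sup>+y. F (x, y) \<partial>\<nu> \<partial>\<kappa>) = (\<integral>\<^sup>+y. \<integral>\<^sup>+x. F (x, y) \<partial>\<kappa> \<partial>\<nu>)"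
proof -
  interpret swap: radon_prob_pair \<nu> \<kappa> ..
  have "(\<integral>\<^sup>+x. \<integral>\<^sup>+y. F (x, y) \<partial>\<nu> \<partial>\<kappa>) = (\<integral>\<^sup>+p. F p \<partial>distr (radon_product \<nu> \<kappa>) borel prod.swap)"
    by (simp add: radon_product_swap nn_integral_radon_product[OF F])
  also have "\<dots> = (\<integral>\<^sup>+p. F (prod.swap p) \<partial>radon_product \<nu> \<kappa>)"
    using F by (simp add: nn_integral_distr[OF swap.measurable_swap_radon_product])
  also have "\<dots> = (\<integral>\<^sup>+y. \<integral>\<^sup>+x. F (x, y) \<partial>\<kappa> \<partial>\<nu>)"
    using swap.nn_integral_radon_product[OF measurable_compose[OF measurable_swap_borel F]] by simp
  finally show ?thesis .
qed

end

subsection \<open>Tonelli's theorem on open sigma-finite sets\<close>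

lemma nn_integral_null_support:
  fixes f :: "'a \<Rightarrow> ennreal"
  assumes "S \<in> null_sets M" and supp: "\<And>x. f x \<noteq> 0 \<Longrightarrow> x \<in> S"
  shows "(\<integral>\<^sup>+x. f x \<partial>M) = 0"
proof -
  have "AE x in M. f x = 0"
    using AE_not_in[OF assms(1)] by eventually_elim (use supp in blast)
  then have "(\<integral>\<^sup>+x. f x \<partial>M) = (\<integral>\<^sup>+x. 0 \<partial>M)" by (rule nn_integral_cong_AE)
  then show ?thesis by simp
qed

lemma nn_integral_neq_0E:
  fixes f :: "'a \<Rightarrow> ennreal"
  assumes "(\<integral>\<^sup>+x. f x \<partial>M) \<noteq> 0"
  obtains x where "f x \<noteq> 0"
proof (rule ccontr)
  assume "\<not> thesis"
  then have "f = (\<lambda>_. 0)" using that by auto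
  with assms show False by simp
qed

lemma nn_integral_eq_uniform_measure:
  assumes f: "f \<in> borel_measurable M" and S: "S \<in> sets M" "emeasure M S \<noteq> 0" "emeasure M S \<noteq> \<infinity>"
    and supp: "\<And>x. f x \<noteq> 0 \<Longrightarrow> x \<in> S"
  shows "(\<integral>\<^sup>+x. f x \<partial>M) = emeasure M S * (\<integral>\<^sup>+x. f x \<partial>uniform_measure M S)"
proof -
  have "f x * indicator S x = f x" for x
    using supp[of x] by (cases "f x = 0") auto
  then show ?thesis
    using S by (simp add: nn_integral_uniform_measure[OF f S(1)] ennreal_times_divide
        mult.commute[of "emeasure M S"] mult_divide_eq_ennreal)
qed

lemma nn_integral_nn_integral_SUP:
  fixes H :: "nat \<Rightarrow> 'a \<times> 'b \<Rightarrow> ennreal"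
  assumes "incseq H" and sections: "\<And>k x. (\<lambda>y. H k (x, y)) \<in> borel_measurable N"
    and integrals: "\<And>k. (\<lambda>x. \<integral>\<^sup>+y. H k (x, y) \<partial>N) \<in> borel_measurable M"
  shows "(\<integral>\<^sup>+x. \<integral>\<^sup>+y. (SUP k. H k (x, y)) \<partial>N \<partial>M) = (SUP k. \<integral>\<^sup>+x. \<integral>\<^sup>+y. H k (x, y) \<partial>N \<partial>M)"
proof -
  have "incseq (\<lambda>k y. H k (x, y))" for x
    using \<open>incseq H\<close> by (auto simp: incseq_def le_fun_def)
  then have "(\<integral>\<^sup>+y. (SUP k. H k (x, y)) \<partial>N) = (SUP k. \<integral>\<^sup>+y. H k (x, y) \<partial>N)" for x
    using sections by (intro nn_integral_monotone_convergence_SUP)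
  moreover have "incseq (\<lambda>k x. \<integral>\<^sup>+y. H k (x, y) \<partial>N)"
    using \<open>incseq H\<close> by (auto simp: incseq_def le_fun_def intro!: nn_integral_mono)
  ultimately show ?thesis
    using integrals by (simp add: nn_integral_monotone_convergence_SUP)
qed

lemma SUP_indicator_mult:
  fixes c :: ennreal
  assumes "c \<noteq> 0 \<Longrightarrow> \<exists>k. x \<in> A k"
  shows "(SUP k. indicator (A k) x * c) = c"
proof (cases "c = 0")
  case False
  with assms obtain k where "x \<in> A k" by blast
  then have "c \<le> (SUP k. indicator (A k) x * c)" by (intro SUP_upper2[of k]) auto
  moreover have "(SUP k. indicator (A k) x * c) \<le> c" by (intro SUP_least) (simp add: indicator_def)
  ultimately show ?thesis by simp
qed simp

lemma incseq_indicator_Times: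
  fixes F :: "'a \<times> 'b \<Rightarrow> ennreal"
  assumes "incseq A" "incseq B"
  shows "incseq (\<lambda>k p. indicator (A k \<times> B k) p * F p)"
proof -
  have "A m \<times> B m \<subseteq> A n \<times> B n" if "m \<le> n" for m n
    using assms[THEN incseqD, OF that] by (rule Sigma_mono)
  then show ?thesis
    unfolding incseq_def le_fun_def by (intro allI impI mult_right_mono indicator_leI) auto
qed

lemma SUP_indicator_Times:
  fixes F :: "'a \<times> 'b \<Rightarrow> ennreal"
  assumes A: "incseq A" and B: "incseq B"
    and supp: "F (x, y) \<noteq> 0 \<Longrightarrow> x \<in> (\<Union>k. A k) \<and> y \<in> (\<Union>k. B k)"
  shows "F (x, y) = (SUP k. indicator (A k \<times> B k) (x, y) * F (x, y))"
proof (rule SUP_indicator_mult[symmetric])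
  assume "F (x, y) \<noteq> 0"
  then obtain i j where "x \<in> A i" "y \<in> B j" using supp by blast
  then show "\<exists>k. (x, y) \<in> A k \<times> B k"
    using incseqD[OF A, of i "max i j"] incseqD[OF B, of j "max i j"]
    by (intro exI[of _ "max i j"]) auto
qed

definition open_sigma_finite :: "'a::topological_space measure \<Rightarrow> 'a set \<Rightarrow> bool" where
  "open_sigma_finite M S \<longleftrightarrow>
     (\<exists>A. (\<forall>n::nat. open (A n) \<and> emeasure M (A n) < \<infinity>) \<and> S \<subseteq> (\<Union>n. A n))"

lemma open_sigma_finite_open:
  "open U \<Longrightarrow> emeasure M U < \<infinity> \<Longrightarrow> open_sigma_finite M U"
  unfolding open_sigma_finite_def by (intro exI[of _ "\<lambda>_. U"]) simp

lemma open_sigma_finite_subset: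
  "open_sigma_finite M T \<Longrightarrow> S \<subseteq> T \<Longrightarrow> open_sigma_finite M S"
  unfolding open_sigma_finite_def by (meson order_trans)

lemma open_sigma_finite_UN:
  assumes "\<And>i::nat. open_sigma_finite M (S i)"
  shows "open_sigma_finite M (\<Union>i. S i)"
proof -
  have "\<forall>i. \<exists>A. (\<forall>n::nat. open (A n) \<and> emeasure M (A n) < \<infinity>) \<and> S i \<subseteq> (\<Union>n. A n)"
    using assms unfolding open_sigma_finite_def by blast
  from choice[OF this] obtain A where A: "\<And>i n. open (A i n :: 'a set)"
      "\<And>i n. emeasure M (A i n) < \<infinity>" "\<And>i. S i \<subseteq> (\<Union>n::nat. A i n)"
    by blast
  have "(\<Union>i. S i) \<subseteq> (\<Union>k. case prod_decode k of (i, n) \<Rightarrow> A i n)"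
  proof
    fix x assume "x \<in> (\<Union>i. S i)"
    then obtain i n where "x \<in> A i n" using A(3) by blast
    then show "x \<in> (\<Union>k. case prod_decode k of (i, n) \<Rightarrow> A i n)"
      by (intro UN_I[of "prod_encode (i, n)"]) simp_all
  qed
  then show ?thesis
    unfolding open_sigma_finite_def using A(1,2)
    by (intro exI[of _ "\<lambda>k. case prod_decode k of (i, n) \<Rightarrow> A i n"]) (simp add: split_beta)
qed

lemma open_sigma_finite_incseq:
  assumes "sets M = sets borel" "open_sigma_finite M S"
  obtains A :: "nat \<Rightarrow> 'a::topological_space set" where "incseq A" "\<And>k. open (A k)"
    "\<And>k. emeasure M (A k) < \<infinity>" "S \<subseteq> (\<Union>k. A k)"
proof -
  obtain B where B: "\<And>n::nat. open (B n)" "\<And>n. emeasure M (B n) < \<infinity>" "S \<subseteq> (\<Union>n. B n)"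
    using assms(2) unfolding open_sigma_finite_def by blast
  show thesis
  proof (rule that[of "\<lambda>k. \<Union>n\<le>k. B n"])
    show "incseq (\<lambda>k. \<Union>n\<le>k. B n)" by (auto simp: incseq_def intro: order_trans)
    show "open (\<Union>n\<le>k. B n)" for k using B(1) by auto
    show "emeasure M (\<Union>n\<le>k. B n) < \<infinity>" for k
    proof -
      have "emeasure M (\<Union>n\<le>k. B n) \<le> (\<Sum>n\<le>k. emeasure M (B n))"
        using B(1) assms(1) by (intro emeasure_subadditive_finite) auto
      also have "\<dots> < \<infinity>" using B(2) by (simp add: ennreal_sum_less_top)
      finally show ?thesis .
    qed
    show "S \<subseteq> (\<Union>k. \<Union>n\<le>k. B n)" using B(3) by blast
  qed
qed

context inner_regular_measure
begin

lemma radon_prob_space_uniform_measure: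
  assumes V: "open V" "emeasure M V \<noteq> 0" "emeasure M V < \<infinity>"
  shows "radon_prob_space (uniform_measure M V)"
proof (intro radon_prob_space.intro inner_regular_measure.intro)
  show "prob_space (uniform_measure M V)"
    using V by (intro prob_space_uniform_measure) auto
  show "sets (uniform_measure M V) = sets borel" by (simp add: sets_borel)
  fix U :: "'a set" assume U: "open U"
  show "emeasure (uniform_measure M V) U
    = (SUP K\<in>{K. compact K \<and> K \<subseteq> U}. emeasure (uniform_measure M V) K)"
  proof (rule antisym)
    have "emeasure (uniform_measure M V) U
        = (SUP K\<in>{K. compact K \<and> K \<subseteq> V \<inter> U}. emeasure M K) / emeasure M V"
      using V(1) U emeasure_open_eq_SUP_compact[of "V \<inter> U"] by (simp add: open_sets open_Int)
    also have "\<dots> = (SUP K\<in>{K. compact K \<and> K \<subseteq> V \<inter> U}. emeasure (uniform_measure M V) K)"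
      unfolding SUP_divide_ennreal using V(1)
      by (intro SUP_cong refl) (auto simp: open_sets compact_sets Int_absorb1)
    also have "\<dots> \<le> (SUP K\<in>{K. compact K \<and> K \<subseteq> U}. emeasure (uniform_measure M V) K)"
      by (intro SUP_subset_mono) auto
    finally show "emeasure (uniform_measure M V) U \<le> \<dots>" .
  qed (use U in \<open>auto intro!: SUP_least emeasure_mono simp: open_sets\<close>)
qed

lemma measurable_section:
  "F \<in> borel_measurable borel \<Longrightarrow> (\<lambda>y. F (x, y)) \<in> borel_measurable M"
  unfolding measurable_borel by (rule measurable_compose[OF measurable_Pair_right_borel])

lemma measurable_nn_integral_open_section:
  fixes F :: "'b::topological_space \<times> 'a \<Rightarrow> ennreal"
  assumes F: "F \<in> borel_measurable borel" and V: "open V" "emeasure M V < \<infinity>"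
    and supp: "\<And>x y. F (x, y) \<noteq> 0 \<Longrightarrow> y \<in> V"
  shows "(\<lambda>x. \<integral>\<^sup>+y. F (x, y) \<partial>M) \<in> borel_measurable borel"
proof (cases "emeasure M V = 0")
  case True
  then have "(\<integral>\<^sup>+y. F (x, y) \<partial>M) = 0" for x
    using V supp by (intro nn_integral_null_support[of V]) (auto intro: null_setsI)
  then show ?thesis by simp
next
  case False
  interpret unif: radon_prob_space "uniform_measure M V"
    using V False by (intro radon_prob_space_uniform_measure)
  have "(\<integral>\<^sup>+y. F (x, y) \<partial>M) = emeasure M V * (\<integral>\<^sup>+y. F (x, y) \<partial>uniform_measure M V)" for x
    using V False supp[of x]
    by (intro nn_integral_eq_uniform_measure measurable_section F) (auto simp: open_sets)
  with unif.measurable_nn_integral_section[OF F] show ?thesis by simp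
qed

lemma measurable_nn_integral_open_sigma_finite_section:
  fixes F :: "'b::topological_space \<times> 'a \<Rightarrow> ennreal"
  assumes F: "F \<in> borel_measurable borel" and T: "open_sigma_finite M T"
    and supp: "\<And>x y. F (x, y) \<noteq> 0 \<Longrightarrow> y \<in> T"
  shows "(\<lambda>x. \<integral>\<^sup>+y. F (x, y) \<partial>M) \<in> borel_measurable borel"
proof -
  obtain B :: "nat \<Rightarrow> 'a set" where B: "incseq B" "\<And>k. open (B k)" "\<And>k. emeasure M (B k) < \<infinity>"
      "T \<subseteq> (\<Union>k. B k)"
    using open_sigma_finite_incseq[OF sets_borel T] by blast
  define H where "H k p = indicator (B k) (snd p) * F p" for k p
  have "snd -` B k \<in> sets (borel :: ('b \<times> 'a) measure)" for k
    using B(2) by (intro borel_open open_vimage continuous_intros)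
  then have H: "H k \<in> borel_measurable borel" for k
    unfolding H_def using F by (simp flip: indicator_vimage)
  have "F (x, y) = (SUP k. H k (x, y))" for x y
    using supp[of x y] B(4) by (auto simp: H_def intro!: SUP_indicator_mult[symmetric])
  moreover have "incseq (\<lambda>k y. H k (x, y))" for x
    using B(1) by (auto simp: H_def incseq_def le_fun_def indicator_def)
  ultimately have "(\<integral>\<^sup>+y. F (x, y) \<partial>M) = (SUP k. \<integral>\<^sup>+y. H k (x, y) \<partial>M)" for x
    using H by (simp add: nn_integral_monotone_convergence_SUP measurable_section)
  moreover have "(\<lambda>x. \<integral>\<^sup>+y. H k (x, y) \<partial>M) \<in> borel_measurable borel" for k
    using B by (intro measurable_nn_integral_open_section[OF H, of "B k"])
      (auto simp: H_def indicator_def split: if_splits)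
  ultimately show ?thesis by simp
qed

end

locale inner_regular_pair = \<kappa>: inner_regular_measure \<kappa> + \<nu>: inner_regular_measure \<nu>
  for \<kappa> :: "'a::t2_space measure" and \<nu> :: "'b::t2_space measure"
begin

lemma iterated_nn_integral_eq_uniform_measures:
  assumes F: "F \<in> borel_measurable borel"
    and U: "open U" "emeasure \<kappa> U \<noteq> 0" "emeasure \<kappa> U < \<infinity>"
    and V: "open V" "emeasure \<nu> V \<noteq> 0" "emeasure \<nu> V < \<infinity>"
    and supp: "\<And>x y. F (x, y) \<noteq> 0 \<Longrightarrow> x \<in> U \<and> y \<in> V"
  shows "(\<integral>\<^sup>+x. \<integral>\<^sup>+y. F (x, y) \<partial>\<nu> \<partial>\<kappa>) = emeasure \<kappa> U * (emeasure \<nu> V *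
    (\<integral>\<^sup>+x. \<integral>\<^sup>+y. F (x, y) \<partial>uniform_measure \<nu> V \<partial>uniform_measure \<kappa> U))"
proof -
  interpret unif: radon_prob_space "uniform_measure \<nu> V"
    by (intro \<nu>.radon_prob_space_uniform_measure V)
  let ?h = "\<lambda>x. \<integral>\<^sup>+y. F (x, y) \<partial>uniform_measure \<nu> V"
  have h_borel: "?h \<in> borel_measurable borel" by (rule unif.measurable_nn_integral_section[OF F])
  have "(\<integral>\<^sup>+y. F (x, y) \<partial>\<nu>) = emeasure \<nu> V * ?h x" for x
    using V supp[of x]
    by (intro nn_integral_eq_uniform_measure \<nu>.measurable_section F) (auto simp: \<nu>.open_sets)
  then have "(\<integral>\<^sup>+x. \<integral>\<^sup>+y. F (x, y) \<partial>\<nu> \<partial>\<kappa>) = emeasure \<nu> V * (\<integral>\<^sup>+x. ?h x \<partial>\<kappa>)"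
    using h_borel by (simp add: nn_integral_cmult \<kappa>.measurable_borel)
  also have "(\<integral>\<^sup>+x. ?h x \<partial>\<kappa>) = emeasure \<kappa> U * (\<integral>\<^sup>+x. ?h x \<partial>uniform_measure \<kappa> U)"
  proof (intro nn_integral_eq_uniform_measure)
    show "x \<in> U" if "?h x \<noteq> 0" for x
      by (rule nn_integral_neq_0E[OF that]) (use supp in blast)
  qed (use h_borel U in \<open>auto simp: \<kappa>.measurable_borel \<kappa>.open_sets\<close>)
  finally show ?thesis by (simp add: mult.left_commute)
qed

lemma tonelli_open:
  assumes F: "F \<in> borel_measurable borel"
    and U: "open U" "emeasure \<kappa> U < \<infinity>" and V: "open V" "emeasure \<nu> V < \<infinity>"
    and supp: "\<And>x y. F (x, y) \<noteq> 0 \<Longrightarrow> x \<in> U \<and> y \<in> V"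
  shows "(\<integral>\<^sup>+x. \<integral>\<^sup>+y. F (x, y) \<partial>\<nu> \<partial>\<kappa>) = (\<integral>\<^sup>+y. \<integral>\<^sup>+x. F (x, y) \<partial>\<kappa> \<partial>\<nu>)"
proof -
  have supp_fst: "x \<in> U" if "(\<integral>\<^sup>+y. F (x, y) \<partial>\<nu>) \<noteq> 0" for x
    by (rule nn_integral_neq_0E[OF that]) (use supp in blast)
  have supp_snd: "y \<in> V" if "(\<integral>\<^sup>+x. F (x, y) \<partial>\<kappa>) \<noteq> 0" for y
    by (rule nn_integral_neq_0E[OF that]) (use supp in blast)
  consider (null_U) "U \<in> null_sets \<kappa>" | (null_V) "V \<in> null_sets \<nu>"
    | (pos) "emeasure \<kappa> U \<noteq> 0" "emeasure \<nu> V \<noteq> 0"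
    using U V by (auto simp: null_sets_def)
  then show ?thesis
  proof cases
    case null_U
    have "(\<integral>\<^sup>+x. F (x, y) \<partial>\<kappa>) = 0" for y
      using supp by (intro nn_integral_null_support[OF null_U]) blast
    moreover have "(\<integral>\<^sup>+x. \<integral>\<^sup>+y. F (x, y) \<partial>\<nu> \<partial>\<kappa>) = 0"
      using supp_fst by (intro nn_integral_null_support[OF null_U]) blast
    ultimately show ?thesis by simp
  next
    case null_V
    have "(\<integral>\<^sup>+y. F (x, y) \<partial>\<nu>) = 0" for x
      using supp by (intro nn_integral_null_support[OF null_V]) blast
    moreover have "(\<integral>\<^sup>+y. \<integral>\<^sup>+x. F (x, y) \<partial>\<kappa> \<partial>\<nu>) = 0"
      using supp_snd by (intro nn_integral_null_support[OF null_V]) blast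
    ultimately show ?thesis by simp
  next
    case pos
    interpret swap: inner_regular_pair \<nu> \<kappa> ..
    interpret unif: radon_prob_pair "uniform_measure \<kappa> U" "uniform_measure \<nu> V"
      using U V pos by (intro radon_prob_pair.intro \<kappa>.radon_prob_space_uniform_measure
          \<nu>.radon_prob_space_uniform_measure)
    have F_swap: "(\<lambda>p. F (prod.swap p)) \<in> borel_measurable borel"
      by (rule measurable_compose[OF measurable_swap_borel F])
    show ?thesis
      using iterated_nn_integral_eq_uniform_measures[OF F U(1) pos(1) U(2) V(1) pos(2) V(2)]
        swap.iterated_nn_integral_eq_uniform_measures[OF F_swap V(1) pos(2) V(2) U(1) pos(1) U(2)]
        supp unif.tonelli_radon[OF F]
      by (simp add: mult.left_commute)
  qed
qed

lemma iterated_nn_integral_SUP: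
  assumes H: "\<And>k. H k \<in> borel_measurable borel" "incseq H"
    and B: "\<And>k. open (B k)" "\<And>k. emeasure \<nu> (B k) < \<infinity>"
    and supp: "\<And>k x y. H k (x, y) \<noteq> 0 \<Longrightarrow> y \<in> B k"
  shows "(\<integral>\<^sup>+x. \<integral>\<^sup>+y. (SUP k. H k (x, y)) \<partial>\<nu> \<partial>\<kappa>) = (SUP k. \<integral>\<^sup>+x. \<integral>\<^sup>+y. H k (x, y) \<partial>\<nu> \<partial>\<kappa>)"
proof (intro nn_integral_nn_integral_SUP H(2) \<nu>.measurable_section H(1))
  show "(\<lambda>x. \<integral>\<^sup>+y. H k (x, y) \<partial>\<nu>) \<in> borel_measurable \<kappa>" for k
    unfolding \<kappa>.measurable_borel
    by (rule \<nu>.measurable_nn_integral_open_section[OF H(1) B supp])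
qed

theorem tonelli_open_sigma_finite:
  assumes F: "F \<in> borel_measurable borel"
    and S: "open_sigma_finite \<kappa> S" and T: "open_sigma_finite \<nu> T"
    and supp: "\<And>x y. F (x, y) \<noteq> 0 \<Longrightarrow> x \<in> S \<and> y \<in> T"
  shows "(\<integral>\<^sup>+x. \<integral>\<^sup>+y. F (x, y) \<partial>\<nu> \<partial>\<kappa>) = (\<integral>\<^sup>+y. \<integral>\<^sup>+x. F (x, y) \<partial>\<kappa> \<partial>\<nu>)"
proof -
  obtain A :: "nat \<Rightarrow> 'a set" where A: "incseq A" "\<And>k. open (A k)" "\<And>k. emeasure \<kappa> (A k) < \<infinity>"
      "S \<subseteq> (\<Union>k. A k)"
    using open_sigma_finite_incseq[OF \<kappa>.sets_borel S] by blast
  obtain B :: "nat \<Rightarrow> 'b set" where B: "incseq B" "\<And>k. open (B k)" "\<And>k. emeasure \<nu> (B k) < \<infinity>"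
      "T \<subseteq> (\<Union>k. B k)"
    using open_sigma_finite_incseq[OF \<nu>.sets_borel T] by blast
  define H where "H k p = indicator (A k \<times> B k) p * F p" for k p
  have H: "H k \<in> borel_measurable borel" for k
    unfolding H_def using F A(2) B(2)
    by (intro borel_measurable_times_ennreal borel_measurable_indicator borel_open open_Times)
  have H_supp: "x \<in> A k \<and> y \<in> B k" if "H k (x, y) \<noteq> 0" for k x y
    using that by (auto simp: H_def indicator_def split: if_splits)
  have "x \<in> (\<Union>k. A k) \<and> y \<in> (\<Union>k. B k)" if "F (x, y) \<noteq> 0" for x y
    using supp[OF that] A(4) B(4) by blast
  note exhaustion = incseq_indicator_Times[OF A(1) B(1)] SUP_indicator_Times[OF A(1) B(1) this]
  have "incseq H" and F_SUP: "F (x, y) = (SUP k. H k (x, y))" for x y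
    unfolding H_def by (rule exhaustion)+
  have "(\<integral>\<^sup>+x. \<integral>\<^sup>+y. F (x, y) \<partial>\<nu> \<partial>\<kappa>) = (SUP k. \<integral>\<^sup>+x. \<integral>\<^sup>+y. H k (x, y) \<partial>\<nu> \<partial>\<kappa>)"
    unfolding F_SUP using H_supp
    by (intro iterated_nn_integral_SUP[of H B] H \<open>incseq H\<close> B(2,3)) blast
  also have "\<dots> = (SUP k. \<integral>\<^sup>+y. \<integral>\<^sup>+x. H k (x, y) \<partial>\<kappa> \<partial>\<nu>)"
    using H_supp A B by (intro SUP_cong refl tonelli_open[OF H, of "A k" "B k" for k]) auto
  also have "\<dots> = (\<integral>\<^sup>+y. \<integral>\<^sup>+x. F (x, y) \<partial>\<kappa> \<partial>\<nu>)"
  proof -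
    interpret swap: inner_regular_pair \<nu> \<kappa> ..
    have "(\<lambda>p. H k (prod.swap p)) \<in> borel_measurable borel" for k
      by (rule measurable_compose[OF measurable_swap_borel H])
    moreover have "incseq (\<lambda>k p. H k (prod.swap p))"
      using \<open>incseq H\<close> by (simp add: incseq_def le_fun_def)
    ultimately show ?thesis
      using swap.iterated_nn_integral_SUP[of "\<lambda>k p. H k (prod.swap p)" A] A(2,3) H_supp
      by (simp add: F_SUP)
  qed
  finally show ?thesis .
qed

end

subsection \<open>The unit ball of \<open>L\<^sup>1\<close>\<close>

abbreviation norm1 :: "'a measure \<Rightarrow> ('a \<Rightarrow> real) \<Rightarrow> real" where
  "norm1 M f \<equiv> (\<integral>x. \<bar>f x\<bar> \<partial>M)"

lemma norm1_triangle:
  assumes "integrable M f" "integrable M g" "integrable M h"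
  shows "norm1 M (\<lambda>x. f x - h x) \<le> norm1 M (\<lambda>x. f x - g x) + norm1 M (\<lambda>x. g x - h x)"
proof -
  have "norm1 M (\<lambda>x. f x - h x) \<le> (\<integral>x. \<bar>f x - g x\<bar> + \<bar>g x - h x\<bar> \<partial>M)"
    using assms by (intro integral_mono) auto
  with assms show ?thesis by simp
qed

lemma norm1_le_norm1_add_diff:
  assumes "integrable M f" "integrable M g"
  shows "norm1 M g \<le> norm1 M f + norm1 M (\<lambda>x. f x - g x)"
  using norm1_triangle[OF assms(2,1) integrable_zero] by (simp add: abs_minus_commute)

lemma norm1_diff_eq_0_iff:
  assumes "integrable M f" "integrable M g"
  shows "norm1 M (\<lambda>x. f x - g x) = 0 \<longleftrightarrow> (AE x in M. f x = g x)"
  using assms by (subst integral_nonneg_eq_0_iff_AE) auto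

lemma nn_integral_norm_diff_AE_limit_le:
  fixes h g :: "'a \<Rightarrow> 'b::{banach, second_countable_topology}"
  assumes [measurable]: "h \<in> borel_measurable M" "\<And>i. f i \<in> borel_measurable M"
    and lim: "AE x in M. (\<lambda>i. f i x) \<longlonglongrightarrow> g x"
    and bounded: "\<forall>\<^sub>F i in sequentially. (\<integral>\<^sup>+x. norm (h x - f i x) \<partial>M) \<le> b"
  shows "(\<integral>\<^sup>+x. norm (h x - g x) \<partial>M) \<le> b"
proof -
  have "AE x in M. ennreal (norm (h x - g x)) = liminf (\<lambda>i. ennreal (norm (h x - f i x)))"
    using lim by eventually_elim (intro lim_imp_Liminf[symmetric] tendsto_intros, simp_all)
  then have "(\<integral>\<^sup>+x. norm (h x - g x) \<partial>M) = (\<integral>\<^sup>+x. liminf (\<lambda>i. ennreal (norm (h x - f i x))) \<partial>M)"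
    by (rule nn_integral_cong_AE)
  also have "\<dots> \<le> liminf (\<lambda>i. \<integral>\<^sup>+x. norm (h x - f i x) \<partial>M)"
    by (rule nn_integral_liminf) simp
  also have "\<dots> \<le> b" using bounded by (intro Liminf_le) simp_all
  finally show ?thesis .
qed

lemma Cauchy_L1_converges:
  fixes f :: "nat \<Rightarrow> 'a \<Rightarrow> 'b::{banach, second_countable_topology}"
  assumes f: "\<And>n. integrable M (f n)"
    and Cauchy: "\<And>e. 0 < e \<Longrightarrow> \<exists>N. \<forall>m\<ge>N. \<forall>n\<ge>N. (\<integral>x. norm (f m x - f n x) \<partial>M) < e"
  obtains g where "integrable M g" "(\<lambda>n. \<integral>x. norm (f n x - g x) \<partial>M) \<longlonglongrightarrow> 0"
proof -
  obtain r where r: "strict_mono r" and AE_Cauchy: "AE x in M. Cauchy (\<lambda>i. f (r i) x)"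
    using cauchy_L1_AE_cauchy_subseq[OF f Cauchy] by blast
  define g where "g x = lim (\<lambda>i. f (r i) x)" for x
  have [measurable]: "f n \<in> borel_measurable M" for n using f by auto
  have [measurable]: "g \<in> borel_measurable M"
    unfolding g_def by (rule borel_measurable_lim_metric) simp
  have lim: "AE x in M. (\<lambda>i. f (r i) x) \<longlonglongrightarrow> g x"
    using AE_Cauchy by eventually_elim (simp add: g_def Cauchy_convergent_iff convergent_LIMSEQ_iff)
  have dist_le: "(\<integral>\<^sup>+x. norm (f n x - g x) \<partial>M) \<le> ennreal e"
    if N: "\<forall>m\<ge>N. \<forall>n\<ge>N. (\<integral>x. norm (f m x - f n x) \<partial>M) < e" and "n \<ge> N" for N n e
  proof (rule nn_integral_norm_diff_AE_limit_le[OF _ _ lim])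
    show "\<forall>\<^sub>F i in sequentially. (\<integral>\<^sup>+x. norm (f n x - f (r i) x) \<partial>M) \<le> ennreal e"
    proof (rule eventually_sequentiallyI)
      fix i assume "N \<le> i"
      then have "N \<le> r i" using seq_suble[OF r, of i] by simp
      with N \<open>n \<ge> N\<close> f show "(\<integral>\<^sup>+x. norm (f n x - f (r i) x) \<partial>M) \<le> ennreal e"
        by (simp add: nn_integral_eq_integral ennreal_leI less_imp_le)
    qed
  qed simp_all
  obtain N where "\<forall>m\<ge>N. \<forall>n\<ge>N. (\<integral>x. norm (f m x - f n x) \<partial>M) < 1"
    using Cauchy[of 1] by auto
  from dist_le[OF this order_refl] have "integrable M (\<lambda>x. f N x - g x)"
    by (intro integrableI_bounded) (auto intro: le_less_trans)
  from Bochner_Integration.integrable_diff[OF f[of N] this] have g: "integrable M g" by simp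
  have "\<exists>N. \<forall>n\<ge>N. norm ((\<integral>x. norm (f n x - g x) \<partial>M) - 0) < e" if "0 < e" for e
  proof -
    obtain N where N: "\<forall>m\<ge>N. \<forall>n\<ge>N. (\<integral>x. norm (f m x - f n x) \<partial>M) < e / 2"
      using Cauchy[of "e / 2"] \<open>0 < e\<close> by auto
    have "(\<integral>x. norm (f n x - g x) \<partial>M) < e" if "n \<ge> N" for n
      using dist_le[OF N that] f g \<open>0 < e\<close> by (simp add: nn_integral_eq_integral ennreal_le_iff)
    then show ?thesis by auto
  qed
  with g show thesis by (intro that LIMSEQ_I)
qed

lemma L1_rep_L1_class:
  assumes "integrable M f"
  shows integrable_L1_rep_L1_class: "integrable M (L1_rep (L1_class M f))"
    and AE_L1_rep_L1_class: "AE x in M. L1_rep (L1_class M f) x = f x"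
proof -
  have "f \<in> L1_class M f" using assms by (simp add: L1_class_def)
  then have "L1_rep (L1_class M f) \<in> L1_class M f"
    unfolding L1_rep_def by (rule someI[where P="\<lambda>h. h \<in> L1_class M f"])
  then show "integrable M (L1_rep (L1_class M f))" "AE x in M. L1_rep (L1_class M f) x = f x"
    by (simp_all add: L1_class_def)
qed

lemma L1_class_cong:
  assumes "AE x in M. f x = g x"
  shows "L1_class M f = L1_class M g"
proof -
  have "(AE x in M. h x = f x) \<longleftrightarrow> (AE x in M. h x = g x)" for h
    using assms by (intro eventually_subst) (auto elim: eventually_mono)
  then show ?thesis by (simp add: L1_class_def)
qed

lemma L1_class_in_L1_space: "integrable M f \<Longrightarrow> L1_class M f \<in> L1_space M"
  by (simp add: L1_space_def)

lemma
  assumes "F \<in> L1_space M"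
  shows integrable_L1_rep: "integrable M (L1_rep F)"
    and L1_class_L1_rep: "L1_class M (L1_rep F) = F"
proof -
  obtain f where f: "integrable M f" "F = L1_class M f"
    using assms by (auto simp: L1_space_def)
  show "integrable M (L1_rep F)" "L1_class M (L1_rep F) = F"
    unfolding f(2) by (rule integrable_L1_rep_L1_class[OF f(1)])
      (rule L1_class_cong[OF AE_L1_rep_L1_class[OF f(1)]])
qed

lemma L1_norm_L1_class:
  assumes "integrable M f"
  shows "L1_norm M (L1_class M f) = norm1 M f"
  unfolding L1_norm_def
  using L1_rep_L1_class[OF assms] assms
  by (intro integral_cong_AE) (auto elim: eventually_mono)

lemma L1_dist_L1_class:
  assumes "integrable M f" "integrable M g"
  shows "L1_dist M (L1_class M f) (L1_class M g) = norm1 M (\<lambda>x. f x - g x)"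
  unfolding L1_dist_def
  using L1_rep_L1_class[OF assms(1)] L1_rep_L1_class[OF assms(2)] assms
  by (intro integral_cong_AE) (auto elim: eventually_elim2)

lemma Metric_space_L1: "Metric_space (L1_space M) (L1_dist M)"
proof
  show "0 \<le> L1_dist M F G" for F G by (simp add: L1_dist_def)
  show "L1_dist M F G = L1_dist M G F" for F G by (simp add: L1_dist_def abs_minus_commute)
next
  fix F G assume "F \<in> L1_space M" "G \<in> L1_space M"
  then show "L1_dist M F G = 0 \<longleftrightarrow> F = G"
    using L1_class_cong[of "L1_rep F" "L1_rep G" M]
    by (auto simp: L1_dist_def norm1_diff_eq_0_iff integrable_L1_rep L1_class_L1_rep)
next
  fix F G H assume "F \<in> L1_space M" "G \<in> L1_space M" "H \<in> L1_space M"
  from this[THEN integrable_L1_rep] show "L1_dist M F H \<le> L1_dist M F G + L1_dist M G H"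
    unfolding L1_dist_def by (rule norm1_triangle)
qed

definition L1_unit_functions :: "'a measure \<Rightarrow> ('a \<Rightarrow> real) set" where
  "L1_unit_functions M = {f. integrable M f \<and> norm1 M f \<le> 1}"

definition L1_ball :: "'a measure \<Rightarrow> ('a \<Rightarrow> real) set set" where
  "L1_ball M = {F \<in> L1_space M. L1_norm M F \<le> 1}"

lemma L1_class_in_L1_ball: "f \<in> L1_unit_functions M \<Longrightarrow> L1_class M f \<in> L1_ball M"
  by (simp add: L1_unit_functions_def L1_ball_def L1_class_in_L1_space L1_norm_L1_class)

lemma L1_rep_in_L1_unit_functions: "F \<in> L1_ball M \<Longrightarrow> L1_rep F \<in> L1_unit_functions M"
  by (simp add: L1_unit_functions_def L1_ball_def L1_norm_def integrable_L1_rep)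

lemma L1_class_L1_rep_ball: "F \<in> L1_ball M \<Longrightarrow> L1_class M (L1_rep F) = F"
  by (simp add: L1_ball_def L1_class_L1_rep)

lemma Metric_space_L1_ball: "Metric_space (L1_ball M) (L1_dist M)"
  by (rule Metric_space.subspace[OF Metric_space_L1]) (auto simp: L1_ball_def)

lemma L1_limit_in_L1_unit_functions:
  assumes f: "\<And>n. f n \<in> L1_unit_functions M" and g: "integrable M g"
    and lim: "(\<lambda>n. norm1 M (\<lambda>x. f n x - g x)) \<longlonglongrightarrow> 0"
  shows "g \<in> L1_unit_functions M"
proof -
  have "norm1 M g \<le> 1 + 0"
  proof (rule LIMSEQ_le_const)
    show "(\<lambda>n. 1 + norm1 M (\<lambda>x. f n x - g x)) \<longlonglongrightarrow> 1 + 0"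
      by (intro tendsto_intros lim)
    have "norm1 M g \<le> 1 + norm1 M (\<lambda>x. f n x - g x)" for n
      using norm1_le_norm1_add_diff[OF _ g, of "f n"] f[of n] by (simp add: L1_unit_functions_def)
    then show "\<exists>N. \<forall>n\<ge>N. norm1 M g \<le> 1 + norm1 M (\<lambda>x. f n x - g x)" by blast
  qed
  with g show ?thesis by (simp add: L1_unit_functions_def)
qed

lemma mcomplete_L1_ball: "Metric_space.mcomplete (L1_ball M) (L1_dist M)"
proof -
  interpret Metric_space "L1_ball M" "L1_dist M" by (rule Metric_space_L1_ball)
  have "\<exists>G. limitin mtopology \<sigma> G sequentially" if "MCauchy \<sigma>" for \<sigma>
  proof -
    have ball: "\<sigma> n \<in> L1_ball M" for n using that by (auto simp: MCauchy_def)
    define f where "f n = L1_rep (\<sigma> n)" for n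
    have f: "f n \<in> L1_unit_functions M" for n
      unfolding f_def by (rule L1_rep_in_L1_unit_functions[OF ball])
    then have f_int: "integrable M (f n)" for n by (simp add: L1_unit_functions_def)
    have "\<exists>N. \<forall>m\<ge>N. \<forall>n\<ge>N. norm1 M (\<lambda>x. f m x - f n x) < e" if "0 < e" for e
    proof -
      obtain N where "\<And>m n. N \<le> m \<Longrightarrow> N \<le> n \<Longrightarrow> L1_dist M (\<sigma> m) (\<sigma> n) < e"
        using \<open>MCauchy \<sigma>\<close> \<open>0 < e\<close> unfolding MCauchy_def by metis
      then show ?thesis unfolding L1_dist_def f_def by blast
    qed
    then obtain g where g: "integrable M g" and lim: "(\<lambda>n. norm1 M (\<lambda>x. f n x - g x)) \<longlonglongrightarrow> 0"
      using Cauchy_L1_converges[of M f, unfolded real_norm_def] f_int by blast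
    have "L1_class M g \<in> L1_ball M"
      by (intro L1_class_in_L1_ball L1_limit_in_L1_unit_functions[OF f g lim])
    moreover have "L1_dist M (\<sigma> n) (L1_class M g) = norm1 M (\<lambda>x. f n x - g x)" for n
      using L1_dist_L1_class[OF f_int g] L1_class_L1_rep_ball[OF ball] by (simp add: f_def)
    ultimately have "limitin mtopology \<sigma> (L1_class M g) sequentially"
      using lim ball by (simp add: limitin_metric_dist_null)
    then show ?thesis ..
  qed
  then show ?thesis unfolding mcomplete_def by blast
qed

definition lipschitz_L1_op ::
    "'a measure \<Rightarrow> real \<Rightarrow> (('a \<Rightarrow> real) \<Rightarrow> ('a \<Rightarrow> real) \<Rightarrow> 'a \<Rightarrow> real) \<Rightarrow> bool" where
  "lipschitz_L1_op M C p \<longleftrightarrow>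
     (\<forall>f\<in>L1_unit_functions M. \<forall>g\<in>L1_unit_functions M. p f g \<in> L1_unit_functions M) \<and>
     (\<forall>f\<in>L1_unit_functions M. \<forall>g\<in>L1_unit_functions M.
        \<forall>f'\<in>L1_unit_functions M. \<forall>g'\<in>L1_unit_functions M.
        norm1 M (\<lambda>x. p f g x - p f' g' x)
          \<le> C * (norm1 M (\<lambda>x. f x - f' x) + norm1 M (\<lambda>x. g x - g' x)))"

lemma L1_lift2_in_L1_ball:
  "lipschitz_L1_op M C p \<Longrightarrow> F \<in> L1_ball M \<Longrightarrow> G \<in> L1_ball M \<Longrightarrow> L1_lift2 M p F G \<in> L1_ball M"
  by (simp add: L1_lift2_def lipschitz_L1_op_def L1_class_in_L1_ball L1_rep_in_L1_unit_functions)

lemma L1_dist_L1_lift2_le: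
  assumes p: "lipschitz_L1_op M C p"
    and "F \<in> L1_ball M" "G \<in> L1_ball M" "F' \<in> L1_ball M" "G' \<in> L1_ball M"
  shows "L1_dist M (L1_lift2 M p F G) (L1_lift2 M p F' G') \<le> C * (L1_dist M F F' + L1_dist M G G')"
proof -
  note reps = assms(2-)[THEN L1_rep_in_L1_unit_functions]
  have "integrable M (p (L1_rep F) (L1_rep G))" "integrable M (p (L1_rep F') (L1_rep G'))"
    using p reps by (auto simp: lipschitz_L1_op_def L1_unit_functions_def)
  then show ?thesis
    using p reps
    by (simp add: L1_lift2_def L1_dist_L1_class) (simp add: lipschitz_L1_op_def L1_dist_def)
qed

lemma L1_lift2_L1_class:
  assumes p: "lipschitz_L1_op M C p"
    and f: "f \<in> L1_unit_functions M" and g: "g \<in> L1_unit_functions M"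
  shows "L1_lift2 M p (L1_class M f) (L1_class M g) = L1_class M (p f g)"
proof -
  let ?f = "L1_rep (L1_class M f)" and ?g = "L1_rep (L1_class M g)"
  have reps: "?f \<in> L1_unit_functions M" "?g \<in> L1_unit_functions M"
    by (intro L1_rep_in_L1_unit_functions L1_class_in_L1_ball f g)+
  have "norm1 M (\<lambda>x. ?f x - f x) = 0" "norm1 M (\<lambda>x. ?g x - g x) = 0"
    using f g by (simp_all add: L1_unit_functions_def norm1_diff_eq_0_iff L1_rep_L1_class)
  moreover have "norm1 M (\<lambda>x. p ?f ?g x - p f g x)
      \<le> C * (norm1 M (\<lambda>x. ?f x - f x) + norm1 M (\<lambda>x. ?g x - g x))"
    using p reps f g unfolding lipschitz_L1_op_def by blast
  ultimately have "norm1 M (\<lambda>x. p ?f ?g x - p f g x) = 0"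
    by (intro antisym) simp_all
  moreover have "integrable M (p ?f ?g)" "integrable M (p f g)"
    using p reps f g by (auto simp: lipschitz_L1_op_def L1_unit_functions_def)
  ultimately have "AE x in M. p ?f ?g x = p f g x"
    by (simp add: norm1_diff_eq_0_iff)
  then show ?thesis
    unfolding L1_lift2_def by (rule L1_class_cong)
qed

definition averaging_op :: "(real \<Rightarrow> real \<Rightarrow> real) \<Rightarrow> bool" where
  "averaging_op p \<longleftrightarrow> p 0 0 = 0 \<and> (\<forall>a b a' b'. \<bar>p a b - p a' b'\<bar> \<le> (\<bar>a - a'\<bar> + \<bar>b - b'\<bar>) / 2)"

lemma averaging_op_lattice_ops:
  "averaging_op (\<lambda>a b. (a + b) / 2)"
  "averaging_op (\<lambda>a b. min a b / 2)"
  "averaging_op (\<lambda>a b. max a b / 2)"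
  by (auto simp: averaging_op_def abs_if min_def max_def field_simps)

lemma measurable_averaging_op:
  assumes p: "averaging_op p" and "f \<in> borel_measurable M" "g \<in> borel_measurable M"
  shows "(\<lambda>x. p (f x) (g x)) \<in> borel_measurable M"
proof -
  have "\<bar>p (fst z) (snd z) - p (fst w) (snd w)\<bar> \<le> 1 * dist z w" for z w :: "real \<times> real"
  proof -
    have "\<bar>p (fst z) (snd z) - p (fst w) (snd w)\<bar> \<le> (\<bar>fst z - fst w\<bar> + \<bar>snd z - snd w\<bar>) / 2"
      using p by (simp add: averaging_op_def)
    with dist_fst_le[of z w] dist_snd_le[of z w] show ?thesis by (simp add: dist_real_def)
  qed
  then have "1-lipschitz_on UNIV (\<lambda>z. p (fst z) (snd z))"
    by (intro lipschitz_onI) (simp_all add: dist_real_def)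
  then have "(\<lambda>z. p (fst z) (snd z)) \<in> borel_measurable borel"
    by (intro borel_measurable_continuous_onI lipschitz_on_continuous_on)
  from measurable_compose[OF borel_measurable_Pair[OF assms(2,3)] this] show ?thesis by simp
qed

lemma integrable_averaging_op:
  assumes p: "averaging_op p" and f: "integrable M f" and g: "integrable M g"
  shows "integrable M (\<lambda>x. p (f x) (g x))"
proof (rule Bochner_Integration.integrable_bound)
  show "integrable M (\<lambda>x. (\<bar>f x\<bar> + \<bar>g x\<bar>) / 2)" using f g by simp
  show "(\<lambda>x. p (f x) (g x)) \<in> borel_measurable M"
    using f g by (intro measurable_averaging_op[OF p]) auto
  have "\<bar>p a b - p 0 0\<bar> \<le> (\<bar>a - 0\<bar> + \<bar>b - 0\<bar>) / 2" "p 0 0 = 0" for a b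
    using p unfolding averaging_op_def by blast+
  then show "AE x in M. norm (p (f x) (g x)) \<le> norm ((\<bar>f x\<bar> + \<bar>g x\<bar>) / 2)" by simp
qed

lemma norm1_averaging_op_diff_le:
  assumes p: "averaging_op p"
    and "integrable M f" "integrable M g" "integrable M f'" "integrable M g'"
  shows "norm1 M (\<lambda>x. p (f x) (g x) - p (f' x) (g' x))
    \<le> 1 / 2 * (norm1 M (\<lambda>x. f x - f' x) + norm1 M (\<lambda>x. g x - g' x))"
proof -
  have "norm1 M (\<lambda>x. p (f x) (g x) - p (f' x) (g' x))
      \<le> (\<integral>x. (\<bar>f x - f' x\<bar> + \<bar>g x - g' x\<bar>) / 2 \<partial>M)"
    using assms by (intro integral_mono) (auto simp: integrable_averaging_op averaging_op_def)
  with assms show ?thesis by simp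
qed

lemma lipschitz_L1_op_averaging_op:
  assumes p: "averaging_op p"
  shows "lipschitz_L1_op M (1 / 2) (\<lambda>f g x. p (f x) (g x))"
proof -
  have "(\<lambda>x. p (f x) (g x)) \<in> L1_unit_functions M"
    if "f \<in> L1_unit_functions M" "g \<in> L1_unit_functions M" for f g
    using norm1_averaging_op_diff_le[OF p, of M f g "\<lambda>_. 0" "\<lambda>_. 0"] that p
    by (simp add: L1_unit_functions_def integrable_averaging_op averaging_op_def)
  then show ?thesis
    unfolding lipschitz_L1_op_def using norm1_averaging_op_diff_le[OF p]
    by (auto simp: L1_unit_functions_def)
qed

subsection \<open>Haar measures\<close>

lemma open_shear:
  fixes V V' :: "'a::topological_group_add set"
  assumes "open V" "open V'"
  shows "open {p. snd p \<in> V \<and> - snd p + fst p \<in> V'}"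
proof -
  have "open (snd -` V \<inter> (\<lambda>p :: 'a \<times> 'a. - snd p + fst p) -` V')"
    using assms by (intro open_Int open_vimage continuous_intros)
  then show ?thesis by (simp add: vimage_def Collect_conj_eq)
qed

lemma open_shear_section:
  fixes V V' :: "'a::topological_group_add set"
  assumes "open V" "open V'"
  shows "open {y \<in> V. - y + x \<in> V'}"
  using open_Pair_vimage[OF open_shear[OF assms], of x] by (simp add: vimage_def)

locale haar_measure =
  fixes \<mu> :: "'a::{topological_group_add, t2_space} measure"
  assumes haar: "left_haar_measure \<mu>"

sublocale haar_measure \<subseteq> inner_regular_measure \<mu>
  using haar by unfold_locales (auto simp: left_haar_measure_def)

context haar_measure
begin

lemma emeasure_compact: "compact K \<Longrightarrow> emeasure \<mu> K < \<infinity>"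
  using haar by (simp add: left_haar_measure_def)

lemma ex_open_superset_emeasure_less:
  assumes "A \<in> sets borel" "emeasure \<mu> A < c"
  obtains U where "open U" "A \<subseteq> U" "emeasure \<mu> U < c"
proof -
  have "(INF U\<in>{U. open U \<and> A \<subseteq> U}. emeasure \<mu> U) < c"
    using haar assms unfolding left_haar_measure_def by metis
  then show ?thesis using that by (auto simp: INF_less_iff)
qed

lemma emeasure_vimage_translate:
  assumes "A \<in> sets borel"
  shows "emeasure \<mu> ((\<lambda>x. g + x) -` A) = emeasure \<mu> A"
proof -
  have "(\<lambda>x. g + x) -` A = (\<lambda>x. - g + x) ` A"
    by (auto intro!: image_eqI[of _ _ "g + _"])
  then show ?thesis using haar assms by (simp add: left_haar_measure_def)
qed

lemma measurable_translate: "(\<lambda>x. g + x) \<in> \<mu> \<rightarrow>\<^sub>M borel"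
  unfolding measurable_borel by (intro borel_measurable_continuous_onI continuous_intros)

lemma distr_translate: "distr \<mu> borel (\<lambda>x. g + x) = \<mu>"
  by (rule measure_eqI)
    (simp_all add: sets_borel emeasure_distr[OF measurable_translate] emeasure_vimage_translate)

lemma nn_integral_translate:
  assumes "F \<in> borel_measurable borel"
  shows "(\<integral>\<^sup>+x. F (g + x) \<partial>\<mu>) = (\<integral>\<^sup>+x. F x \<partial>\<mu>)"
  using nn_integral_distr[OF measurable_translate[of g], of F] assms by (simp add: distr_translate)

lemma
  fixes f :: "'a \<Rightarrow> real"
  assumes "integrable \<mu> f"
  shows integrable_translate: "integrable \<mu> (\<lambda>x. f (g + x))"
    and integral_translate: "(\<integral>x. f (g + x) \<partial>\<mu>) = (\<integral>x. f x \<partial>\<mu>)"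
proof -
  have "f \<in> borel_measurable borel" using assms by (auto simp flip: measurable_borel)
  then show "integrable \<mu> (\<lambda>x. f (g + x))" "(\<integral>x. f (g + x) \<partial>\<mu>) = (\<integral>x. f x \<partial>\<mu>)"
    using integrable_distr[OF measurable_translate[of g], of f] assms
      integral_distr[OF measurable_translate[of g], of f]
    by (simp_all add: distr_translate)
qed

lemma emeasure_open_pos:
  assumes U: "open U" "U \<noteq> {}"
  shows "0 < emeasure \<mu> U"
proof (rule ccontr)
  assume "\<not> 0 < emeasure \<mu> U"
  then have "emeasure \<mu> U = 0" by simp
  obtain u where u: "u \<in> U" using U by auto
  define T where "T g = (\<lambda>x. g + x) -` U" for g
  have open_T: "open (T g)" for g
    unfolding T_def using U(1) by (intro open_vimage continuous_intros)
  have null_T: "T g \<in> null_sets \<mu>" for g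
    using open_T[of g] emeasure_vimage_translate[of U g] U(1) \<open>emeasure \<mu> U = 0\<close>
    by (auto simp: T_def null_sets_def)
  have null_compact: "emeasure \<mu> K = 0" if K: "compact K" for K
  proof -
    have "x \<in> T (u - x)" for x using u by (simp add: T_def)
    then have "K \<subseteq> (\<Union>g\<in>UNIV. T g)" by blast
    then obtain D where D: "finite D" "K \<subseteq> (\<Union>g\<in>D. T g)"
      using compactE_image[OF K, of UNIV T] open_T by auto
    then have "(\<Union>g\<in>D. T g) \<in> null_sets \<mu>"
      using null_T by (intro null_sets_UN' countable_finite)
    from null_sets_subset[OF this compact_sets[OF K] D(2)] show ?thesis by auto
  qed
  have "emeasure \<mu> UNIV = (SUP K\<in>{K. compact K \<and> K \<subseteq> UNIV}. emeasure \<mu> K)"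
    by (rule emeasure_open_eq_SUP_compact) simp
  also have "\<dots> \<le> 0" using null_compact by (intro SUP_least) simp
  finally show False using haar by (simp add: left_haar_measure_def)
qed

text \<open>
  A Haar measure need not be sigma-finite, nor even semifinite on Borel sets; but integrable
  functions and their convolutions live on open sigma-finite sets.
\<close>

lemma open_sigma_finite_finite_measure:
  assumes "A \<in> sets borel" "emeasure \<mu> A < \<infinity>"
  shows "open_sigma_finite \<mu> A"
proof -
  obtain U where "open U" "A \<subseteq> U" "emeasure \<mu> U < \<infinity>"
    using ex_open_superset_emeasure_less[OF assms] .
  then show ?thesis using open_sigma_finite_open open_sigma_finite_subset by blast
qed

lemma open_sigma_finite_support:
  fixes f :: "'a \<Rightarrow> real"
  assumes f: "integrable \<mu> f"
  shows "open_sigma_finite \<mu> {x. f x \<noteq> 0}"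
proof -
  define S where "S n = {x. 1 / real (Suc n) \<le> \<bar>f x\<bar>}" for n
  have [measurable]: "f \<in> borel_measurable borel"
    using borel_measurable_integrable[OF f] by (simp add: measurable_borel)
  have "open_sigma_finite \<mu> (\<Union>n. S n)"
  proof (intro open_sigma_finite_UN open_sigma_finite_finite_measure)
    fix n
    show "S n \<in> sets borel" unfolding S_def by measurable
    have "emeasure \<mu> {x\<in>space \<mu>. 1 / real (Suc n) \<le> \<bar>f x\<bar>}
        \<le> ennreal (1 / (1 / real (Suc n)) * (\<integral>x. \<bar>f x\<bar> \<partial>\<mu>))"
      using f by (intro integral_Markov_inequality) auto
    also have "\<dots> < \<infinity>" by simp
    finally show "emeasure \<mu> (S n) < \<infinity>" by (simp add: S_def)
  qed
  moreover have "{x. f x \<noteq> 0} \<subseteq> (\<Union>n. S n)"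
  proof
    fix x assume "x \<in> {x. f x \<noteq> 0}"
    then obtain n where "inverse (real (Suc n)) < \<bar>f x\<bar>"
      using reals_Archimedean[of "\<bar>f x\<bar>"] by auto
    then show "x \<in> (\<Union>n. S n)" by (auto simp: S_def inverse_eq_divide intro: less_imp_le)
  qed
  ultimately show ?thesis by (rule open_sigma_finite_subset)
qed

lemma emeasure_compact_sections_le:
  assumes K: "compact K" and V: "open V" "emeasure \<mu> V < \<infinity>" and V': "open V'"
    and sections: "\<And>x. x \<in> K \<Longrightarrow> c \<le> emeasure \<mu> {y \<in> V. - y + x \<in> V'}"
  shows "c * emeasure \<mu> K \<le> emeasure \<mu> V * emeasure \<mu> V'"
proof -
  interpret inner_regular_pair \<mu> \<mu> ..
  define W where "W = {p :: 'a \<times> 'a. snd p \<in> V \<and> - snd p + fst p \<in> V'}"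
  define F :: "'a \<times> 'a \<Rightarrow> ennreal" where "F = indicator (fst -` K \<inter> W)"
  have "fst -` K \<in> sets (borel :: ('a \<times> 'a) measure)"
    using K by (intro borel_closed closed_vimage compact_imp_closed continuous_intros)
  moreover have "W \<in> sets borel"
    using open_shear[OF V(1) V'] by (simp add: W_def)
  ultimately have F: "F \<in> borel_measurable borel" by (simp add: F_def)
  have "F (x, y) = indicator K x * indicator {y \<in> V. - y + x \<in> V'} y" for x y
    by (auto simp: F_def W_def indicator_def)
  then have x_section:
    "(\<integral>\<^sup>+y. F (x, y) \<partial>\<mu>) = indicator K x * emeasure \<mu> {y \<in> V. - y + x \<in> V'}" for x
    using open_shear_section[OF V(1) V'] by (simp add: nn_integral_cmult_indicator open_sets)
  have "c * emeasure \<mu> K = (\<integral>\<^sup>+x. c * indicator K x \<partial>\<mu>)"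
    using K by (simp add: nn_integral_cmult_indicator compact_sets)
  also have "\<dots> \<le> (\<integral>\<^sup>+x. \<integral>\<^sup>+y. F (x, y) \<partial>\<mu> \<partial>\<mu>)"
    unfolding x_section using sections by (intro nn_integral_mono) (auto simp: indicator_def)
  also have "\<dots> = (\<integral>\<^sup>+y. \<integral>\<^sup>+x. F (x, y) \<partial>\<mu> \<partial>\<mu>)"
    using K V emeasure_compact
    by (intro tonelli_open_sigma_finite[OF F, of K V] open_sigma_finite_finite_measure)
      (auto simp: F_def W_def indicator_def borel_compact split: if_splits)
  also have "\<dots> \<le> (\<integral>\<^sup>+y. emeasure \<mu> V' * indicator V y \<partial>\<mu>)"
  proof (rule nn_integral_mono)
    fix y
    have "(\<integral>\<^sup>+x. F (x, y) \<partial>\<mu>) \<le> (\<integral>\<^sup>+x. indicator V y * indicator V' (- y + x) \<partial>\<mu>)"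
      by (intro nn_integral_mono) (auto simp: F_def W_def indicator_def)
    also have "\<dots> = indicator V y * emeasure \<mu> V'"
      using V' nn_integral_translate[of "\<lambda>x. indicator V y * indicator V' x" "- y"]
      by (simp add: nn_integral_cmult_indicator open_sets)
    finally show "(\<integral>\<^sup>+x. F (x, y) \<partial>\<mu>) \<le> emeasure \<mu> V' * indicator V y" by (simp add: mult.commute)
  qed
  also have "\<dots> = emeasure \<mu> V * emeasure \<mu> V'"
    using V(1) by (subst nn_integral_cmult_indicator) (auto simp: open_sets mult.commute)
  finally show ?thesis .
qed

text \<open>
  The function \<open>x \<mapsto> \<mu> (V \<inter> (x - V'))\<close> is lower semicontinuous and positive exactly on the sum set,
  and Tonelli's theorem over compact sets bounds the measure of the open sets where it exceeds
  \<open>1 / k\<close>.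
\<close>

lemma open_sigma_finite_sum_open:
  assumes V: "open V" "emeasure \<mu> V < \<infinity>" and V': "open V'" "emeasure \<mu> V' < \<infinity>"
  shows "open_sigma_finite \<mu> {x. \<exists>y\<in>V. - y + x \<in> V'}"
proof -
  define W where "W = {p :: 'a \<times> 'a. snd p \<in> V \<and> - snd p + fst p \<in> V'}"
  have W: "open W" unfolding W_def by (intro open_shear V V')
  have Pair_W: "Pair x -` W = {y \<in> V. - y + x \<in> V'}" for x by (auto simp: W_def)
  define R where "R k = {x. ennreal (inverse (real (Suc k))) < emeasure \<mu> (Pair x -` W)}" for k
  have open_R: "open (R k)" for k
    unfolding R_def by (rule open_emeasure_section_gt[OF W])
  have "emeasure \<mu> (R k) < \<infinity>" for k
  proof -
    let ?c = "ennreal (inverse (real (Suc k)))"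
    have "?c * emeasure \<mu> K \<le> emeasure \<mu> V * emeasure \<mu> V'" if "compact K" "K \<subseteq> R k" for K
      using that V V' by (intro emeasure_compact_sections_le) (auto simp: R_def Pair_W)
    then have "?c * emeasure \<mu> (R k) \<le> emeasure \<mu> V * emeasure \<mu> V'"
      unfolding emeasure_open_eq_SUP_compact[OF open_R] SUP_mult_left_ennreal
      by (intro SUP_least) simp
    also have "\<dots> < \<infinity>" using V V' by (simp add: ennreal_mult_less_top)
    finally show ?thesis by (auto simp: ennreal_mult_less_top)
  qed
  moreover have "{x. \<exists>y\<in>V. - y + x \<in> V'} \<subseteq> (\<Union>k. R k)"
  proof
    fix x assume "x \<in> {x. \<exists>y\<in>V. - y + x \<in> V'}"
    then have "Pair x -` W \<noteq> {}" by (auto simp: Pair_W)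
    then have "0 < emeasure \<mu> (Pair x -` W)"
      by (intro emeasure_open_pos open_Pair_vimage W)
    then obtain q :: rat where q: "0 < ennreal (real_of_rat q)"
        "ennreal (real_of_rat q) < emeasure \<mu> (Pair x -` W)"
      using ennreal_rat_dense by blast
    then obtain k where "inverse (real (Suc k)) < real_of_rat q"
      using reals_Archimedean[of "real_of_rat q"] by auto
    then have "ennreal (inverse (real (Suc k))) \<le> ennreal (real_of_rat q)"
      by (intro ennreal_leI) simp
    with q(2) have "x \<in> R k" unfolding R_def by (auto intro: le_less_trans)
    then show "x \<in> (\<Union>k. R k)" by blast
  qed
  ultimately show ?thesis
    unfolding open_sigma_finite_def using open_R by (intro exI[of _ R]) simp
qed

lemma open_sigma_finite_sum:
  assumes "open_sigma_finite \<mu> S" "open_sigma_finite \<mu> T"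
  shows "open_sigma_finite \<mu> {x. \<exists>y\<in>S. - y + x \<in> T}"
proof -
  obtain A where A: "\<And>i::nat. open (A i)" "\<And>i. emeasure \<mu> (A i) < \<infinity>" "S \<subseteq> (\<Union>i. A i)"
    using assms(1) unfolding open_sigma_finite_def by blast
  obtain B where B: "\<And>j::nat. open (B j)" "\<And>j. emeasure \<mu> (B j) < \<infinity>" "T \<subseteq> (\<Union>j. B j)"
    using assms(2) unfolding open_sigma_finite_def by blast
  have "open_sigma_finite \<mu> (\<Union>i j. {x. \<exists>y\<in>A i. - y + x \<in> B j})"
    by (intro open_sigma_finite_UN open_sigma_finite_sum_open A B)
  moreover have "{x. \<exists>y\<in>S. - y + x \<in> T} \<subseteq> (\<Union>i j. {x. \<exists>y\<in>A i. - y + x \<in> B j})"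
  proof
    fix x assume "x \<in> {x. \<exists>y\<in>S. - y + x \<in> T}"
    then obtain y where "y \<in> S" "- y + x \<in> T" by blast
    moreover obtain i where "y \<in> A i" using \<open>y \<in> S\<close> A(3) by blast
    moreover obtain j where "- y + x \<in> B j" using \<open>- y + x \<in> T\<close> B(3) by blast
    ultimately show "x \<in> (\<Union>i j. {x. \<exists>y\<in>A i. - y + x \<in> B j})" by blast
  qed
  ultimately show ?thesis by (rule open_sigma_finite_subset)
qed

subsection \<open>Convolution\<close>

abbreviation convolve :: "('a \<Rightarrow> real) \<Rightarrow> ('a \<Rightarrow> real) \<Rightarrow> 'a \<Rightarrow> real" (infixl "\<star>" 75) where
  "f \<star> g \<equiv> group_convolution \<mu> f g"

context
  fixes f g :: "'a \<Rightarrow> real"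
  assumes f: "integrable \<mu> f" and g: "integrable \<mu> g"
begin

lemma measurable_convolution_factors:
  "(\<lambda>p. f (snd p)) \<in> borel_measurable (borel :: ('a \<times> 'a) measure)"
  "(\<lambda>p. g (- snd p + fst p)) \<in> borel_measurable (borel :: ('a \<times> 'a) measure)"
proof -
  have "f \<in> borel_measurable borel" "g \<in> borel_measurable borel"
    using f g by (auto simp flip: measurable_borel)
  moreover have "snd \<in> borel \<rightarrow>\<^sub>M (borel :: 'a measure)"
      "(\<lambda>p. - snd p + fst p) \<in> borel \<rightarrow>\<^sub>M (borel :: 'a measure)"
    by (intro borel_measurable_continuous_onI continuous_intros)+
  ultimately show "(\<lambda>p. f (snd p)) \<in> borel_measurable (borel :: ('a \<times> 'a) measure)"
    "(\<lambda>p. g (- snd p + fst p)) \<in> borel_measurable (borel :: ('a \<times> 'a) measure)"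
    by (auto intro: measurable_compose)
qed

lemma
  fixes \<phi> :: "real \<Rightarrow> ennreal"
  assumes \<phi>: "\<phi> \<in> borel_measurable borel" "\<phi> 0 = 0"
  shows measurable_nn_integral_convolution:
      "(\<lambda>x. \<integral>\<^sup>+y. \<phi> (f y * g (- y + x)) \<partial>\<mu>) \<in> borel_measurable borel"
    and nn_integral_convolution_swap:
      "(\<integral>\<^sup>+x. \<integral>\<^sup>+y. \<phi> (f y * g (- y + x)) \<partial>\<mu> \<partial>\<mu>)
        = (\<integral>\<^sup>+y. \<integral>\<^sup>+x. \<phi> (f y * g (- y + x)) \<partial>\<mu> \<partial>\<mu>)"
proof -
  interpret inner_regular_pair \<mu> \<mu> ..
  let ?F = "\<lambda>p. \<phi> (f (snd p) * g (- snd p + fst p))"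
  let ?S = "{x. f x \<noteq> 0}" and ?T = "{x. g x \<noteq> 0}"
  have F: "?F \<in> borel_measurable borel"
    using measurable_convolution_factors
    by (intro measurable_compose[OF _ \<phi>(1)] borel_measurable_times)
  have supp: "y \<in> ?S" "x \<in> {x. \<exists>y\<in>?S. - y + x \<in> ?T}" if "?F (x, y) \<noteq> 0" for x y
  proof -
    have "f y * g (- y + x) \<noteq> 0" using that \<phi>(2) by auto
    then show "y \<in> ?S" "x \<in> {x. \<exists>y\<in>?S. - y + x \<in> ?T}" by auto
  qed
  show "(\<lambda>x. \<integral>\<^sup>+y. \<phi> (f y * g (- y + x)) \<partial>\<mu>) \<in> borel_measurable borel"
    using measurable_nn_integral_open_sigma_finite_section[OF F
        open_sigma_finite_support[OF f] supp(1)]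
    by simp
  show "(\<integral>\<^sup>+x. \<integral>\<^sup>+y. \<phi> (f y * g (- y + x)) \<partial>\<mu> \<partial>\<mu>) = (\<integral>\<^sup>+y. \<integral>\<^sup>+x. \<phi> (f y * g (- y + x)) \<partial>\<mu> \<partial>\<mu>)"
    using tonelli_open_sigma_finite[OF F open_sigma_finite_sum[OF open_sigma_finite_support[OF f]
          open_sigma_finite_support[OF g]] open_sigma_finite_support[OF f]] supp
    by simp
qed

lemma nn_integral_convolution:
  "(\<integral>\<^sup>+x. \<integral>\<^sup>+y. ennreal \<bar>f y * g (- y + x)\<bar> \<partial>\<mu> \<partial>\<mu>) = ennreal (norm1 \<mu> f * norm1 \<mu> g)"
proof -
  have g_borel: "g \<in> borel_measurable borel"
    using g by (auto simp flip: measurable_borel)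
  have "(\<integral>\<^sup>+x. \<integral>\<^sup>+y. ennreal \<bar>f y * g (- y + x)\<bar> \<partial>\<mu> \<partial>\<mu>)
      = (\<integral>\<^sup>+y. \<integral>\<^sup>+x. ennreal \<bar>f y * g (- y + x)\<bar> \<partial>\<mu> \<partial>\<mu>)"
    by (rule nn_integral_convolution_swap) simp_all
  also have "\<dots> = (\<integral>\<^sup>+y. ennreal \<bar>f y\<bar> * ennreal (norm1 \<mu> g) \<partial>\<mu>)"
  proof (rule nn_integral_cong)
    fix y
    have "(\<integral>\<^sup>+x. ennreal \<bar>f y * g (- y + x)\<bar> \<partial>\<mu>) = (\<integral>\<^sup>+x. ennreal \<bar>f y * g x\<bar> \<partial>\<mu>)"
      using g_borel by (intro nn_integral_translate[of "\<lambda>x. ennreal \<bar>f y * g x\<bar>"]) simp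
    also have "\<dots> = ennreal \<bar>f y\<bar> * ennreal (norm1 \<mu> g)"
      using g by (simp add: abs_mult ennreal_mult nn_integral_cmult nn_integral_eq_integral)
    finally show "(\<integral>\<^sup>+x. ennreal \<bar>f y * g (- y + x)\<bar> \<partial>\<mu>) = ennreal \<bar>f y\<bar> * ennreal (norm1 \<mu> g)" .
  qed
  also have "\<dots> = ennreal (norm1 \<mu> f * norm1 \<mu> g)"
    using f by (simp add: nn_integral_multc nn_integral_eq_integral ennreal_mult)
  finally show ?thesis .
qed

lemma measurable_convolution_integrand: "(\<lambda>y. f y * g (- y + x)) \<in> borel_measurable \<mu>"
  using measurable_compose[OF measurable_Pair_right_borel measurable_convolution_factors(2), of x] f
  by (auto simp: measurable_borel)

lemma AE_integrable_convolution: "AE x in \<mu>. integrable \<mu> (\<lambda>y. f y * g (- y + x))"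
proof -
  have "(\<lambda>x. \<integral>\<^sup>+y. ennreal \<bar>f y * g (- y + x)\<bar> \<partial>\<mu>) \<in> borel_measurable \<mu>"
    unfolding measurable_borel by (rule measurable_nn_integral_convolution) simp_all
  then have "AE x in \<mu>. (\<integral>\<^sup>+y. ennreal \<bar>f y * g (- y + x)\<bar> \<partial>\<mu>) \<noteq> \<infinity>"
    using nn_integral_convolution by (intro nn_integral_PInf_AE) simp_all
  then show ?thesis
  proof eventually_elim
    case (elim x)
    then show ?case
      using measurable_convolution_integrand[of x]
      by (intro integrableI_bounded) (auto simp: less_top)
  qed
qed

lemma measurable_convolution: "f \<star> g \<in> borel_measurable borel"
proof -
  define P where "P s x = (\<integral>\<^sup>+y. ennreal (s * (f y * g (- y + x))) \<partial>\<mu>)" for s x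
  have [measurable]: "P s \<in> borel_measurable borel" for s
    unfolding P_def by (rule measurable_nn_integral_convolution[of "\<lambda>t. ennreal (s * t)"]) simp_all
  \<comment> \<open>the Bochner integral of a function that is not integrable is \<open>0\<close>\<close>
  have "(f \<star> g) x
      = (if P 1 x \<noteq> \<infinity> \<and> P (-1) x \<noteq> \<infinity> then enn2real (P 1 x) - enn2real (P (-1) x) else 0)" for x
  proof -
    have "integrable \<mu> (\<lambda>y. f y * g (- y + x)) \<longleftrightarrow> P 1 x \<noteq> \<infinity> \<and> P (-1) x \<noteq> \<infinity>"
      using measurable_convolution_integrand[of x] by (simp add: real_integrable_def P_def)
    then show ?thesis
      by (auto simp: group_convolution_def not_integrable_integral_eq
          real_lebesgue_integral_def P_def)
  qed
  then show ?thesis by (subst measurable_cong) measurable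
qed

lemma nn_integral_abs_convolution_le:
  "(\<integral>\<^sup>+x. ennreal \<bar>(f \<star> g) x\<bar> \<partial>\<mu>) \<le> ennreal (norm1 \<mu> f * norm1 \<mu> g)"
  unfolding nn_integral_convolution[symmetric]
proof (rule nn_integral_mono)
  fix x
  show "ennreal \<bar>(f \<star> g) x\<bar> \<le> (\<integral>\<^sup>+y. ennreal \<bar>f y * g (- y + x)\<bar> \<partial>\<mu>)"
  proof (cases "integrable \<mu> (\<lambda>y. f y * g (- y + x))")
    case True
    then show ?thesis
      using integral_norm_bound_ennreal[OF True] by (simp add: group_convolution_def)
  qed (simp add: group_convolution_def not_integrable_integral_eq)
qed

lemma integrable_convolution: "integrable \<mu> (f \<star> g)"
  using measurable_convolution nn_integral_abs_convolution_le
  by (intro integrableI_bounded) (auto simp: measurable_borel intro: le_less_trans)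

lemma norm1_convolution_le: "norm1 \<mu> (f \<star> g) \<le> norm1 \<mu> f * norm1 \<mu> g"
  using nn_integral_abs_convolution_le integrable_convolution
  by (simp add: nn_integral_eq_integral)

lemma integral_convolution_nonneg:
  assumes nonneg: "\<And>x. 0 \<le> f x" "\<And>x. 0 \<le> g x"
  shows "(\<integral>x. (f \<star> g) x \<partial>\<mu>) = (\<integral>x. f x \<partial>\<mu>) * (\<integral>x. g x \<partial>\<mu>)"
proof -
  have convolution_nonneg: "0 \<le> (f \<star> g) x" for x
    unfolding group_convolution_def using nonneg by simp
  have "ennreal (\<integral>x. (f \<star> g) x \<partial>\<mu>) = (\<integral>\<^sup>+x. ennreal ((f \<star> g) x) \<partial>\<mu>)"
    using integrable_convolution convolution_nonneg
    by (intro nn_integral_eq_integral[symmetric]) auto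
  also have "\<dots> = (\<integral>\<^sup>+x. \<integral>\<^sup>+y. ennreal \<bar>f y * g (- y + x)\<bar> \<partial>\<mu> \<partial>\<mu>)"
  proof (rule nn_integral_cong_AE)
    show "AE x in \<mu>. ennreal ((f \<star> g) x) = (\<integral>\<^sup>+y. ennreal \<bar>f y * g (- y + x)\<bar> \<partial>\<mu>)"
      using AE_integrable_convolution
      by eventually_elim (simp add: group_convolution_def nonneg nn_integral_eq_integral)
  qed
  also have "\<dots> = ennreal ((\<integral>x. f x \<partial>\<mu>) * (\<integral>x. g x \<partial>\<mu>))"
    using nn_integral_convolution nonneg by simp
  finally show ?thesis using convolution_nonneg nonneg by simp
qed

end

lemma norm1_convolution_diff_le:
  assumes f: "integrable \<mu> f" and g: "integrable \<mu> g"
    and f': "integrable \<mu> f'" and g': "integrable \<mu> g'"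
  shows "norm1 \<mu> (\<lambda>x. (f \<star> g) x - (f' \<star> g') x)
    \<le> norm1 \<mu> (\<lambda>x. f x - f' x) * norm1 \<mu> g + norm1 \<mu> f' * norm1 \<mu> (\<lambda>x. g x - g' x)"
proof -
  define df where "df x = f x - f' x" for x
  define dg where "dg x = g x - g' x" for x
  have df: "integrable \<mu> df" and dg: "integrable \<mu> dg"
    unfolding df_def dg_def using assms by auto
  note integrable_convolutions = integrable_convolution[OF f g] integrable_convolution[OF f' g']
    integrable_convolution[OF df g] integrable_convolution[OF f' dg]
  have "AE x in \<mu>. \<bar>(f \<star> g) x - (f' \<star> g') x\<bar> \<le> \<bar>(df \<star> g) x\<bar> + \<bar>(f' \<star> dg) x\<bar>"
    using AE_integrable_convolution[OF f g] AE_integrable_convolution[OF f' g]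
      AE_integrable_convolution[OF f' g']
  proof eventually_elim
    case (elim x)
    have "(df \<star> g) x = (f \<star> g) x - (f' \<star> g) x"
      unfolding group_convolution_def df_def left_diff_distrib
      by (rule Bochner_Integration.integral_diff[OF elim(1,2)])
    moreover have "(f' \<star> dg) x = (f' \<star> g) x - (f' \<star> g') x"
      unfolding group_convolution_def dg_def right_diff_distrib
      by (rule Bochner_Integration.integral_diff[OF elim(2,3)])
    ultimately show ?case by simp
  qed
  then have "norm1 \<mu> (\<lambda>x. (f \<star> g) x - (f' \<star> g') x) \<le> (\<integral>x. \<bar>(df \<star> g) x\<bar> + \<bar>(f' \<star> dg) x\<bar> \<partial>\<mu>)"
    using integrable_convolutions
    by (intro integral_mono_AE integrable_abs Bochner_Integration.integrable_diff
        Bochner_Integration.integrable_add)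
  also have "\<dots> = norm1 \<mu> (df \<star> g) + norm1 \<mu> (f' \<star> dg)"
    using integrable_convolutions by (intro Bochner_Integration.integral_add integrable_abs)
  also have "\<dots> \<le> norm1 \<mu> df * norm1 \<mu> g + norm1 \<mu> f' * norm1 \<mu> dg"
    using assms df dg by (intro add_mono norm1_convolution_le)
  finally show ?thesis by (simp add: df_def dg_def)
qed

lemma lipschitz_L1_op_convolution: "lipschitz_L1_op \<mu> 1 (\<star>)"
  unfolding lipschitz_L1_op_def
proof (intro conjI ballI)
  fix f g assume "f \<in> L1_unit_functions \<mu>" "g \<in> L1_unit_functions \<mu>"
  then have int: "integrable \<mu> f" "integrable \<mu> g" and norm: "norm1 \<mu> f \<le> 1" "norm1 \<mu> g \<le> 1"
    by (auto simp: L1_unit_functions_def)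
  have "norm1 \<mu> f * norm1 \<mu> g \<le> 1" using norm by (intro mult_le_one) simp_all
  then show "f \<star> g \<in> L1_unit_functions \<mu>"
    using norm1_convolution_le[OF int] integrable_convolution[OF int]
    by (simp add: L1_unit_functions_def)
  fix f' g' assume "f' \<in> L1_unit_functions \<mu>" "g' \<in> L1_unit_functions \<mu>"
  then have int': "integrable \<mu> f'" "integrable \<mu> g'" and norm': "norm1 \<mu> f' \<le> 1"
    by (auto simp: L1_unit_functions_def)
  note norm1_convolution_diff_le[OF int int']
  also have "norm1 \<mu> (\<lambda>x. f x - f' x) * norm1 \<mu> g + norm1 \<mu> f' * norm1 \<mu> (\<lambda>x. g x - g' x)
      \<le> norm1 \<mu> (\<lambda>x. f x - f' x) * 1 + 1 * norm1 \<mu> (\<lambda>x. g x - g' x)"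
    using norm norm' by (intro add_mono mult_mono) simp_all
  finally show "norm1 \<mu> (\<lambda>x. (f \<star> g) x - (f' \<star> g') x)
      \<le> 1 * (norm1 \<mu> (\<lambda>x. f x - f' x) + norm1 \<mu> (\<lambda>x. g x - g' x))" by simp
qed

end

subsection \<open>The metric structure\<close>

lemma L1_structure_simps:
  "universe (L1_structure \<mu>) = L1_ball \<mu>"
  "distance (L1_structure \<mu>) = L1_dist \<mu>"
  "rel_interp (L1_structure \<mu>) q Fs = L1_norm \<mu> (Fs ! 0)"
  "fun_interp (L1_structure \<mu>) Zero Fs = L1_class \<mu> (\<lambda>_. 0)"
  "fun_interp (L1_structure \<mu>) Convol Fs = L1_lift2 \<mu> (group_convolution \<mu>) (Fs ! 0) (Fs ! 1)"
  by (simp_all add: L1_structure_def L1_ball_def)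

lemma zero_in_L1_unit_functions: "(\<lambda>_. 0) \<in> L1_unit_functions M"
  by (simp add: L1_unit_functions_def)

lemma L1_norm_range: "F \<in> L1_ball M \<Longrightarrow> L1_norm M F \<in> {0..1}"
  by (simp add: L1_ball_def L1_norm_def)

lemma L1_norm_diff_le:
  assumes "F \<in> L1_ball M" "G \<in> L1_ball M"
  shows "\<bar>L1_norm M F - L1_norm M G\<bar> \<le> L1_dist M F G"
proof -
  have "integrable M (L1_rep F)" "integrable M (L1_rep G)"
    using assms by (auto simp: L1_ball_def integrable_L1_rep)
  from norm1_le_norm1_add_diff[OF this] norm1_le_norm1_add_diff[OF this(2,1)] show ?thesis
    by (simp add: L1_norm_def L1_dist_def abs_minus_commute)
qed

lemma L1_dist_le_2:
  assumes "F \<in> L1_ball M" "G \<in> L1_ball M"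
  shows "L1_dist M F G \<le> 2"
proof -
  have "integrable M (L1_rep F)" "integrable M (L1_rep G)"
    using assms by (auto simp: L1_ball_def integrable_L1_rep)
  from norm1_triangle[OF this(1) integrable_zero this(2)] assms show ?thesis
    by (simp add: L1_ball_def L1_norm_def L1_dist_def)
qed

lemma tuples_nth: "xs \<in> tuples A n \<Longrightarrow> i < n \<Longrightarrow> xs ! i \<in> A"
  using nth_mem by (fastforce simp: tuples_def)

context haar_measure
begin

lemma fun_interp_binary:
  assumes "s \<noteq> Zero"
  obtains C p where "0 < C" "lipschitz_L1_op \<mu> C p" "\<And>\<epsilon>. fun_modulus L_cnv s \<epsilon> = \<epsilon> / (2 * C)"
    "\<And>Fs. fun_interp (L1_structure \<mu>) s Fs = L1_lift2 \<mu> p (Fs ! 0) (Fs ! 1)"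
proof (cases s)
  case Plus
  show thesis
    by (rule that[OF _ lipschitz_L1_op_averaging_op[OF averaging_op_lattice_ops(1)]])
      (simp_all add: Plus L_cnv_def L1_structure_def)
next
  case Meet
  show thesis
    by (rule that[OF _ lipschitz_L1_op_averaging_op[OF averaging_op_lattice_ops(2)]])
      (simp_all add: Meet L_cnv_def L1_structure_def)
next
  case Join
  show thesis
    by (rule that[OF _ lipschitz_L1_op_averaging_op[OF averaging_op_lattice_ops(3)]])
      (simp_all add: Join L_cnv_def L1_structure_def)
next
  case Convol
  show thesis
    by (rule that[OF _ lipschitz_L1_op_convolution])
      (simp_all add: Convol L_cnv_def L1_structure_def)
qed (use assms in simp)

lemma fun_interp_in_L1_ball:
  assumes Fs: "Fs \<in> tuples (L1_ball \<mu>) (fun_arity L_cnv s)"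
  shows "fun_interp (L1_structure \<mu>) s Fs \<in> L1_ball \<mu>"
proof (cases "s = Zero")
  case True
  then show ?thesis
    by (simp add: L1_structure_simps L1_class_in_L1_ball zero_in_L1_unit_functions)
next
  case False
  then obtain C p where "lipschitz_L1_op \<mu> C p"
      "\<And>Fs. fun_interp (L1_structure \<mu>) s Fs = L1_lift2 \<mu> p (Fs ! 0) (Fs ! 1)"
    by (rule fun_interp_binary) blast
  moreover have "fun_arity L_cnv s = 2" using False by (simp add: L_cnv_def)
  ultimately show ?thesis
    using Fs by (simp add: L1_lift2_in_L1_ball tuples_nth)
qed

lemma fun_interp_uniformly_continuous:
  assumes Fs: "Fs \<in> tuples (L1_ball \<mu>) (fun_arity L_cnv s)"
    and Gs: "Gs \<in> tuples (L1_ball \<mu>) (fun_arity L_cnv s)"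
    and dist: "\<And>i. i < fun_arity L_cnv s \<Longrightarrow> L1_dist \<mu> (Fs ! i) (Gs ! i) < fun_modulus L_cnv s \<epsilon>"
    and \<epsilon>_pos: "0 < \<epsilon>"
  shows "L1_dist \<mu> (fun_interp (L1_structure \<mu>) s Fs) (fun_interp (L1_structure \<mu>) s Gs) \<le> \<epsilon>"
proof (cases "s = Zero")
  case True
  then show ?thesis using \<epsilon>_pos by (simp add: L1_structure_simps L1_dist_def)
next
  case False
  then obtain C p where C_pos: "0 < C" and p: "lipschitz_L1_op \<mu> C p"
      and modulus: "\<And>\<epsilon>. fun_modulus L_cnv s \<epsilon> = \<epsilon> / (2 * C)"
      and interp: "\<And>Fs. fun_interp (L1_structure \<mu>) s Fs = L1_lift2 \<mu> p (Fs ! 0) (Fs ! 1)"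
    by (rule fun_interp_binary) blast
  have arity: "fun_arity L_cnv s = 2" using False by (simp add: L_cnv_def)
  have "L1_dist \<mu> (fun_interp (L1_structure \<mu>) s Fs) (fun_interp (L1_structure \<mu>) s Gs)
      \<le> C * (L1_dist \<mu> (Fs ! 0) (Gs ! 0) + L1_dist \<mu> (Fs ! 1) (Gs ! 1))"
    unfolding interp using Fs Gs
    by (intro L1_dist_L1_lift2_le[OF p]) (simp_all add: arity tuples_nth)
  also have "\<dots> \<le> C * (\<epsilon> / (2 * C) + \<epsilon> / (2 * C))"
    using dist[of 0] dist[of 1] C_pos
    by (intro mult_left_mono add_mono) (simp_all add: arity modulus)
  also have "\<dots> = \<epsilon>" using C_pos by simp
  finally show ?thesis .
qed

lemma metric_structure_L1_structure: "metric_structure L_cnv (L1_structure \<mu>)"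
  unfolding metric_structure_def L1_structure_simps
proof (intro conjI)
  show "L1_ball \<mu> \<noteq> {}"
    using L1_class_in_L1_ball[OF zero_in_L1_unit_functions] by blast
  show "Metric_space (L1_ball \<mu>) (L1_dist \<mu>)" by (rule Metric_space_L1_ball)
  show "Metric_space.mcomplete (L1_ball \<mu>) (L1_dist \<mu>)" by (rule mcomplete_L1_ball)
  show "\<forall>F\<in>L1_ball \<mu>. \<forall>G\<in>L1_ball \<mu>. L1_dist \<mu> F G \<le> diam_bound L_cnv"
    by (auto simp: L_cnv_def intro: L1_dist_le_2)
  show "\<forall>s. \<forall>Fs\<in>tuples (L1_ball \<mu>) (fun_arity L_cnv s).
      fun_interp (L1_structure \<mu>) s Fs \<in> L1_ball \<mu>"
    using fun_interp_in_L1_ball by blast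
  show "\<forall>s. \<forall>Fs\<in>tuples (L1_ball \<mu>) (fun_arity L_cnv s). \<forall>Gs\<in>tuples (L1_ball \<mu>) (fun_arity L_cnv s).
      \<forall>\<epsilon>>0. (\<forall>i<fun_arity L_cnv s. L1_dist \<mu> (Fs ! i) (Gs ! i) < fun_modulus L_cnv s \<epsilon>) \<longrightarrow>
        L1_dist \<mu> (fun_interp (L1_structure \<mu>) s Fs) (fun_interp (L1_structure \<mu>) s Gs) \<le> \<epsilon>"
    by (intro allI ballI impI fun_interp_uniformly_continuous) auto
  show "\<forall>r. \<forall>Fs\<in>tuples (L1_ball \<mu>) (rel_arity L_cnv r). L1_norm \<mu> (Fs ! 0) \<in> rel_range L_cnv r"
  proof (intro allI ballI)
    fix r Fs assume "Fs \<in> tuples (L1_ball \<mu>) (rel_arity L_cnv r)"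
    from L1_norm_range[OF tuples_nth[OF this, of 0]]
    show "L1_norm \<mu> (Fs ! 0) \<in> rel_range L_cnv r" by (simp add: L_cnv_def)
  qed
  show "\<forall>r. \<forall>Fs\<in>tuples (L1_ball \<mu>) (rel_arity L_cnv r). \<forall>Gs\<in>tuples (L1_ball \<mu>) (rel_arity L_cnv r).
      \<forall>\<epsilon>>0. (\<forall>i<rel_arity L_cnv r. L1_dist \<mu> (Fs ! i) (Gs ! i) < rel_modulus L_cnv r \<epsilon>) \<longrightarrow>
        \<bar>L1_norm \<mu> (Fs ! 0) - L1_norm \<mu> (Gs ! 0)\<bar> \<le> \<epsilon>"
  proof (intro allI ballI impI)
    fix r Fs Gs and \<epsilon> :: real
    assume tuples: "Fs \<in> tuples (L1_ball \<mu>) (rel_arity L_cnv r)"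
        "Gs \<in> tuples (L1_ball \<mu>) (rel_arity L_cnv r)"
      and dist: "\<forall>i<rel_arity L_cnv r. L1_dist \<mu> (Fs ! i) (Gs ! i) < rel_modulus L_cnv r \<epsilon>"
    have "\<bar>L1_norm \<mu> (Fs ! 0) - L1_norm \<mu> (Gs ! 0)\<bar> \<le> L1_dist \<mu> (Fs ! 0) (Gs ! 0)"
      by (intro L1_norm_diff_le tuples[THEN tuples_nth]) (simp_all add: L_cnv_def)
    also have "\<dots> \<le> \<epsilon>" using dist by (simp add: L_cnv_def)
    finally show "\<bar>L1_norm \<mu> (Fs ! 0) - L1_norm \<mu> (Gs ! 0)\<bar> \<le> \<epsilon>" .
  qed
qed

lemma is_model_L1_structure: "is_model L_cnv (Th L_cnv (L1_structure \<mu>)) (L1_structure \<mu>)"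
  by (simp add: is_model_def metric_structure_L1_structure Th_def)

definition convolution_dist :: "('a \<Rightarrow> real) \<Rightarrow> ('a \<Rightarrow> real) \<Rightarrow> real" where
  "convolution_dist f g = norm1 \<mu> (\<lambda>x. f x - (f \<star> g) x)"

lemma eval_Dist_Convol:
  assumes f: "f \<in> L1_unit_functions \<mu>" and g: "g \<in> L1_unit_functions \<mu>"
  shows "eval (L1_structure \<mu>) (\<sigma>(0 := L1_class \<mu> f, 1 := L1_class \<mu> g))
      (Dist (Var 0) (Fn Convol [Var 0, Var 1])) = convolution_dist f g"
proof -
  have "f \<star> g \<in> L1_unit_functions \<mu>"
    using lipschitz_L1_op_convolution f g by (simp add: lipschitz_L1_op_def)
  with f have "integrable \<mu> f" "integrable \<mu> (f \<star> g)"
    by (simp_all add: L1_unit_functions_def)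
  then show ?thesis
    by (simp add: L1_structure_simps L1_lift2_L1_class[OF lipschitz_L1_op_convolution f g]
        L1_dist_L1_class convolution_dist_def)
qed

end

subsection \<open>Normalised indicators\<close>

definition prob_density :: "'a measure \<Rightarrow> ('a \<Rightarrow> real) \<Rightarrow> bool" where
  "prob_density M f \<longleftrightarrow> integrable M f \<and> (\<forall>x. 0 \<le> f x) \<and> (\<integral>x. f x \<partial>M) = 1"

lemma prob_density_in_L1_unit_functions: "prob_density M f \<Longrightarrow> f \<in> L1_unit_functions M"
  by (simp add: prob_density_def L1_unit_functions_def)

lemma norm1_prob_density_diff:
  assumes "prob_density M f" "prob_density M g"
  shows "norm1 M (\<lambda>x. f x - g x) = 2 * (\<integral>x. max 0 (f x - g x) \<partial>M)"
proof -
  have "norm1 M (\<lambda>x. f x - g x) = (\<integral>x. 2 * max 0 (f x - g x) - (f x - g x) \<partial>M)"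
    by (intro Bochner_Integration.integral_cong) (auto simp: max_def)
  with assms show ?thesis by (simp add: prob_density_def)
qed

lemma norm1_prob_density_diff_le_2:
  assumes "prob_density M f" "prob_density M g"
  shows "norm1 M (\<lambda>x. f x - g x) \<le> 2"
proof -
  have "norm1 M (\<lambda>x. f x - g x) \<le> (\<integral>x. f x + g x \<partial>M)"
    using assms
    by (intro integral_mono) (auto simp: prob_density_def abs_le_iff add_increasing add_increasing2)
  with assms show ?thesis by (simp add: prob_density_def)
qed

definition average :: "'a measure \<Rightarrow> 'a set \<Rightarrow> 'a \<Rightarrow> real" where
  "average M A x = indicator A x / measure M A"

lemma fmeasurable_measure_pos:
  assumes "0 < measure M A"
  shows "A \<in> fmeasurable M"
proof (rule fmeasurableI)
  show "A \<in> sets M"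
    using assms measure_notin_sets[of A M] by (cases "A \<in> sets M") simp_all
  show "emeasure M A < \<infinity>"
    using assms by (simp add: measure_def enn2real_positive_iff)
qed

lemma prob_density_average:
  assumes "0 < measure M A"
  shows "prob_density M (average M A)"
  using fmeasurable_measure_pos[OF assms] assms
  by (auto simp: prob_density_def average_def[abs_def] fmeasurable_def)

lemma norm1_average_diff_ge:
  assumes A: "0 < measure M A" and g: "prob_density M g" "\<And>x. g x \<le> b"
  shows "2 * (1 - b * measure M A) \<le> norm1 M (\<lambda>x. average M A x - g x)"
proof -
  note A_fmeasurable = fmeasurable_measure_pos[OF A]
  have "1 - b * measure M A = (\<integral>x. indicator A x * (1 / measure M A - b) \<partial>M)"
    using A A_fmeasurable by (simp add: field_simps fmeasurable_def)
  also have "\<dots> \<le> (\<integral>x. max 0 (average M A x - g x) \<partial>M)"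
  proof (rule integral_mono)
    show "integrable M (\<lambda>x. indicator A x * (1 / measure M A - b))"
      using A_fmeasurable by (auto simp: fmeasurable_def)
    show "integrable M (\<lambda>x. max 0 (average M A x - g x))"
      using prob_density_average[OF A] g(1) by (auto simp: prob_density_def)
    show "indicator A x * (1 / measure M A - b) \<le> max 0 (average M A x - g x)" for x
      using g(2)[of x] by (auto simp: average_def indicator_def)
  qed
  finally show ?thesis
    using norm1_prob_density_diff[OF prob_density_average[OF A] g(1)] by simp
qed

lemma norm1_average_diff_le:
  assumes A: "0 < measure M A" and g: "prob_density M g" "\<And>x. g x \<le> 1 / measure M A"
    and W: "W \<in> fmeasurable M" "\<And>x. x \<notin> W \<Longrightarrow> g x = 0"
  shows "norm1 M (\<lambda>x. average M A x - g x) \<le> 2 * (measure M (W - A) / measure M A)"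
proof -
  have Diff_fmeasurable: "W - A \<in> fmeasurable M"
    using W(1) fmeasurable_measure_pos[OF A] by (intro fmeasurable_Diff) auto
  have "(\<integral>x. max 0 (g x - average M A x) \<partial>M) \<le> (\<integral>x. indicator (W - A) x / measure M A \<partial>M)"
  proof (rule integral_mono)
    show "integrable M (\<lambda>x. max 0 (g x - average M A x))"
      using prob_density_average[OF A] g(1) by (auto simp: prob_density_def)
    show "integrable M (\<lambda>x. indicator (W - A) x / measure M A)"
      using Diff_fmeasurable by (auto simp: fmeasurable_def)
    show "max 0 (g x - average M A x) \<le> indicator (W - A) x / measure M A" for x
      using g(2)[of x] W(2)[of x] A
      by (cases "x \<in> W"; cases "x \<in> A") (auto simp: average_def)
  qed
  also have "\<dots> = measure M (W - A) / measure M A" using Diff_fmeasurable by simp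
  finally show ?thesis
    using norm1_prob_density_diff[OF g(1) prob_density_average[OF A]]
    by (simp add: abs_minus_commute)
qed

context haar_measure
begin

lemma prob_density_convolution:
  assumes "prob_density \<mu> f" "prob_density \<mu> g"
  shows "prob_density \<mu> (f \<star> g)"
  using integrable_convolution[of f g] integral_convolution_nonneg[of f g] assms
  by (auto simp: prob_density_def group_convolution_def intro!: Bochner_Integration.integral_nonneg)

lemma convolution_le_right:
  assumes f: "prob_density \<mu> f" and g: "\<And>x. g x \<le> b" "0 \<le> b"
  shows "(f \<star> g) x \<le> b"
proof -
  have "(f \<star> g) x \<le> (\<integral>y. f y * b \<partial>\<mu>)"
    unfolding group_convolution_def using f g
    by (intro integral_mono') (auto simp: prob_density_def intro!: mult_left_mono)
  with f show ?thesis by (simp add: prob_density_def)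
qed

text \<open>
  As \<open>g\<close> is even, \<open>y \<mapsto> g (- y + x)\<close> is a left translate of \<open>g\<close>, so that the modular function does
  not enter.
\<close>

lemma convolution_le_left:
  assumes g: "prob_density \<mu> g" "\<And>x. g (- x) = g x" and f: "\<And>x. f x \<le> b" "0 \<le> b"
  shows "(f \<star> g) x \<le> b"
proof -
  have "g (- y + x) = g (- x + y)" for y
    using g(2)[of "- y + x"] by (simp add: minus_add)
  then have "(f \<star> g) x \<le> (\<integral>y. b * g (- x + y) \<partial>\<mu>)"
    unfolding group_convolution_def using f g(1) integrable_translate[of g "- x"]
    by (intro integral_mono') (auto simp: prob_density_def intro!: mult_right_mono)
  also have "\<dots> = b" using integral_translate[of g "- x"] g(1) by (simp add: prob_density_def)
  finally show ?thesis .
qed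

lemma convolution_eq_0:
  assumes "\<And>y. f y \<noteq> 0 \<Longrightarrow> g (- y + x) = 0"
  shows "(f \<star> g) x = 0"
proof -
  have "f y * g (- y + x) = 0" for y using assms by (cases "f y = 0") simp_all
  then have "(\<lambda>y. f y * g (- y + x)) = (\<lambda>_. 0)" ..
  then show ?thesis by (simp add: group_convolution_def)
qed

lemma convolution_dist_average_tendsto_2:
  assumes V: "\<And>n. 0 < measure \<mu> (V n)" "(\<lambda>n. measure \<mu> (V n)) \<longlonglongrightarrow> 0"
    and g: "prob_density \<mu> g" "\<And>x. g x \<le> b"
  shows "(\<lambda>n. convolution_dist (average \<mu> (V n)) g) \<longlonglongrightarrow> 2"
proof (rule tendsto_sandwich)
  have "0 \<le> b" using g order_trans[of 0 "g 0" b] by (simp add: prob_density_def)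
  note densities = prob_density_average[OF V(1)]
  note conv_densities = prob_density_convolution[OF densities g(1)]
  show "\<forall>\<^sub>F n in sequentially. 2 * (1 - b * measure \<mu> (V n))
      \<le> convolution_dist (average \<mu> (V n)) g"
    using norm1_average_diff_ge[OF V(1) conv_densities
        convolution_le_right[OF densities g(2) \<open>0 \<le> b\<close>]]
    by (simp add: convolution_dist_def)
  show "\<forall>\<^sub>F n in sequentially. convolution_dist (average \<mu> (V n)) g \<le> 2"
    using norm1_prob_density_diff_le_2[OF densities conv_densities]
    by (simp add: convolution_dist_def)
  have "(\<lambda>n. 2 * (1 - b * measure \<mu> (V n))) \<longlonglongrightarrow> 2 * (1 - b * 0)"
    by (intro tendsto_intros V(2))
  then show "(\<lambda>n. 2 * (1 - b * measure \<mu> (V n))) \<longlonglongrightarrow> 2" by simp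
qed simp

end

definition symmetric_nbhd :: "'a::{topological_space, group_add} set \<Rightarrow> bool" where
  "symmetric_nbhd U \<longleftrightarrow> open U \<and> 0 \<in> U \<and> (\<forall>u\<in>U. - u \<in> U)"

lemma ex_symmetric_nbhd_subset:
  fixes N :: "'a::topological_group_add set"
  assumes "open N" "0 \<in> N"
  obtains U where "symmetric_nbhd U" "U \<subseteq> N"
proof (rule that)
  show "symmetric_nbhd (N \<inter> uminus -` N)"
    using assms by (auto simp: symmetric_nbhd_def intro!: open_Int open_vimage continuous_intros)
qed auto

lemma average_symmetric_nbhd_uminus: "symmetric_nbhd U \<Longrightarrow> average M U (- x) = average M U x"
  by (force simp: symmetric_nbhd_def average_def indicator_def)

lemma ex_open_nbhd_compact_add_subset:
  fixes V :: "'a::topological_group_add set"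
  assumes V: "compact V" and W: "open W" "V \<subseteq> W"
  shows "\<exists>N. open N \<and> 0 \<in> N \<and> (\<forall>y\<in>V. \<forall>u\<in>N. y + u \<in> W)"
proof -
  have "open ((\<lambda>p. snd p + fst p) -` W)"
    using W(1) by (intro open_vimage continuous_intros)
  moreover have "{0} \<times> V \<subseteq> (\<lambda>p. snd p + fst p) -` W" using W(2) by auto
  ultimately have "\<exists>N. 0 \<in> N \<and> open N \<and> N \<times> V \<subseteq> (\<lambda>p. snd p + fst p) -` W"
    by (rule Elementary_Topology.tube_lemma[OF V])
  then show ?thesis by (auto simp: subset_iff)
qed

context haar_measure
begin

lemma measure_open_pos:
  assumes "open U" "U \<noteq> {}" "emeasure \<mu> U < \<infinity>"
  shows "0 < measure \<mu> U"
  using emeasure_open_pos[OF assms(1,2)] assms(3)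
  by (simp add: measure_def enn2real_positive_iff less_top)

lemma ex_open_superset_measure_Diff_less:
  assumes A: "A \<in> fmeasurable \<mu>" and "0 < d"
  obtains W where "open W" "A \<subseteq> W" "W \<in> fmeasurable \<mu>" "measure \<mu> (W - A) < d"
proof -
  have "A \<in> sets borel" using A by (auto simp: sets_borel)
  have "emeasure \<mu> A < ennreal (measure \<mu> A + d)"
    using A \<open>0 < d\<close> by (simp add: emeasure_eq_measure2 ennreal_less_iff)
  then obtain W where W: "open W" "A \<subseteq> W" "emeasure \<mu> W < ennreal (measure \<mu> A + d)"
    by (rule ex_open_superset_emeasure_less[OF \<open>A \<in> sets borel\<close>])
  have W_fmeasurable: "W \<in> fmeasurable \<mu>"
    using W by (intro fmeasurableI) (auto intro: less_trans)
  with W(3) have "measure \<mu> W < measure \<mu> A + d"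
    by (simp add: emeasure_eq_measure2 ennreal_less_iff)
  moreover have "measure \<mu> (W - A) = measure \<mu> W - measure \<mu> A"
    using A W(2) W_fmeasurable by (intro measurable_measure_Diff) auto
  ultimately show thesis using that W W_fmeasurable by simp
qed

lemma ex_approximate_unit:
  assumes V: "compact V" "0 < measure \<mu> V" and \<epsilon>_pos: "0 < \<epsilon>"
  shows "\<exists>N. open N \<and> 0 \<in> N \<and>
    (\<forall>U\<subseteq>N. symmetric_nbhd U \<longrightarrow> emeasure \<mu> U < \<infinity> \<longrightarrow>
      convolution_dist (average \<mu> V) (average \<mu> U) \<le> \<epsilon>)"
proof -
  have "0 < \<epsilon> * measure \<mu> V / 2" using V(2) \<epsilon>_pos by simp
  then obtain W where W: "open W" "V \<subseteq> W" "W \<in> fmeasurable \<mu>"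
      "measure \<mu> (W - V) < \<epsilon> * measure \<mu> V / 2"
    by (rule ex_open_superset_measure_Diff_less[OF fmeasurable_measure_pos[OF V(2)]])
  obtain N where N: "open N" "0 \<in> N" "\<forall>y\<in>V. \<forall>u\<in>N. y + u \<in> W"
    using ex_open_nbhd_compact_add_subset[OF V(1) W(1,2)] by blast
  show ?thesis
  proof (intro exI[of _ N] conjI N(1,2) allI impI)
    fix U assume U: "U \<subseteq> N" "symmetric_nbhd U" "emeasure \<mu> U < \<infinity>"
    then have "0 < measure \<mu> U"
      by (intro measure_open_pos) (auto simp: symmetric_nbhd_def)
    note densities = prob_density_average[OF V(2)] prob_density_average[OF this]
    have bound: "(average \<mu> V \<star> average \<mu> U) x \<le> 1 / measure \<mu> V" for x
      by (intro convolution_le_left densities average_symmetric_nbhd_uminus U)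
        (auto simp: average_def indicator_def)
    have supp: "(average \<mu> V \<star> average \<mu> U) x = 0" if "x \<notin> W" for x
    proof (rule convolution_eq_0)
      fix y assume "average \<mu> V y \<noteq> 0"
      then have "y \<in> V" by (auto simp: average_def indicator_def split: if_splits)
      have "- y + x \<notin> U"
      proof
        assume "- y + x \<in> U"
        then have "y + (- y + x) \<in> W" using N(3) U(1) \<open>y \<in> V\<close> by blast
        with that show False by simp
      qed
      then show "average \<mu> U (- y + x) = 0" by (simp add: average_def)
    qed
    have "convolution_dist (average \<mu> V) (average \<mu> U)
        \<le> 2 * (measure \<mu> (W - V) / measure \<mu> V)"
      unfolding convolution_dist_def
      by (rule norm1_average_diff_le[OF V(2) prob_density_convolution[OF densities]
            bound W(3) supp])
    also have "\<dots> \<le> \<epsilon>" using W(4) V(2) by (simp add: field_simps)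
    finally show "convolution_dist (average \<mu> V) (average \<mu> U) \<le> \<epsilon>" .
  qed
qed

lemma ex_open_nbhd_finite_measure:
  obtains F :: "'a set" where "open F" "0 \<in> F" "emeasure \<mu> F < \<infinity>"
proof -
  have "emeasure \<mu> {0} < \<infinity>" by (rule emeasure_compact) simp
  then show thesis
    by (rule ex_open_superset_emeasure_less[rotated]) (use that in auto)
qed

lemma ex_common_approximate_unit:
  assumes V: "\<And>i. compact (V i)" "\<And>i. 0 < measure \<mu> (V i)" and \<epsilon>_pos: "0 < \<epsilon>" and "finite I"
  shows "\<exists>U. symmetric_nbhd U \<and> emeasure \<mu> U < \<infinity> \<and>
    (\<forall>i\<in>I. convolution_dist (average \<mu> (V i)) (average \<mu> U) \<le> \<epsilon>)"
proof -
  have "\<forall>i. \<exists>N. open N \<and> 0 \<in> N \<and>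
      (\<forall>U\<subseteq>N. symmetric_nbhd U \<longrightarrow> emeasure \<mu> U < \<infinity> \<longrightarrow>
        convolution_dist (average \<mu> (V i)) (average \<mu> U) \<le> \<epsilon>)"
    by (intro allI ex_approximate_unit V \<epsilon>_pos)
  from choice[OF this] obtain N where N: "\<And>i. open (N i)" "\<And>i. 0 \<in> N i"
      "\<And>i U. U \<subseteq> N i \<Longrightarrow> symmetric_nbhd U \<Longrightarrow> emeasure \<mu> U < \<infinity> \<Longrightarrow>
        convolution_dist (average \<mu> (V i)) (average \<mu> U) \<le> \<epsilon>"
    by blast
  obtain F :: "'a set" where F: "open F" "0 \<in> F" "emeasure \<mu> F < \<infinity>"
    by (rule ex_open_nbhd_finite_measure)
  obtain U where U: "symmetric_nbhd U" "U \<subseteq> F \<inter> (\<Inter>i\<in>I. N i)"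
    by (rule ex_symmetric_nbhd_subset[of "F \<inter> (\<Inter>i\<in>I. N i)"]) (use F N \<open>finite I\<close> in auto)
  have "emeasure \<mu> U < \<infinity>"
    using emeasure_mono[of U F \<mu>] U F by (auto intro: le_less_trans)
  moreover have "U \<subseteq> N i" if "i \<in> I" for i using U(2) that by blast
  ultimately show ?thesis using U(1) N(3) by blast
qed

lemma ex_approximate_unit_sequence:
  fixes V :: "nat \<Rightarrow> 'a set"
  assumes V: "\<And>n. compact (V n)" "\<And>n. 0 < measure \<mu> (V n)"
  obtains U where "\<And>m. 0 < measure \<mu> (U m)"
    "\<And>n. (\<lambda>m. convolution_dist (average \<mu> (V n)) (average \<mu> (U m))) \<longlonglongrightarrow> 0"
proof -
  let ?d = "\<lambda>n U. convolution_dist (average \<mu> (V n)) (average \<mu> U)"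
  have "\<forall>m. \<exists>U. symmetric_nbhd U \<and> emeasure \<mu> U < \<infinity> \<and> (\<forall>n\<in>{..m}. ?d n U \<le> inverse (real (Suc m)))"
    by (intro allI ex_common_approximate_unit V) auto
  from choice[OF this] obtain U where U: "\<And>m. symmetric_nbhd (U m)" "\<And>m. emeasure \<mu> (U m) < \<infinity>"
      "\<And>n m. n \<le> m \<Longrightarrow> ?d n (U m) \<le> inverse (real (Suc m))"
    by auto
  show thesis
  proof (rule that)
    show "0 < measure \<mu> (U m)" for m
      using U(1,2)[of m] by (intro measure_open_pos) (auto simp: symmetric_nbhd_def)
    show "(\<lambda>m. ?d n (U m)) \<longlonglongrightarrow> 0" for n
    proof (rule tendsto_sandwich[OF _ _ tendsto_const LIMSEQ_inverse_real_of_nat])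
      show "\<forall>\<^sub>F m in sequentially. ?d n (U m) \<le> inverse (real (Suc m))"
        using U(3) by (rule eventually_sequentiallyI)
    qed (simp add: convolution_dist_def)
  qed
qed

end

subsection \<open>Small compact sets in non-discrete groups\<close>

lemma finite_if_emeasure_singleton_ge:
  assumes A: "A \<in> sets M" "emeasure M A < \<infinity>"
    and "0 < c" and singletons: "\<And>x. x \<in> A \<Longrightarrow> {x} \<in> sets M" "\<And>x. x \<in> A \<Longrightarrow> c \<le> emeasure M {x}"
  shows "finite A"
proof (rule ccontr)
  assume "infinite A"
  have "of_nat n * c \<le> emeasure M A" for n
  proof -
    obtain T where T: "T \<subseteq> A" "finite T" "card T = n"
      using infinite_arbitrarily_large[OF \<open>infinite A\<close>] by blast
    have "of_nat n * c \<le> (\<Sum>x\<in>T. emeasure M {x})"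
      using T singletons(2) sum_mono[of T "\<lambda>_. c" "\<lambda>x. emeasure M {x}"] by auto
    also have "\<dots> = emeasure M T"
      using T singletons(1) by (intro emeasure_eq_sum_singleton[symmetric]) auto
    also have "\<dots> \<le> emeasure M A" using T A by (intro emeasure_mono)
    finally show ?thesis .
  qed
  then have "(SUP n. of_nat n) * c \<le> emeasure M A"
    unfolding SUP_mult_right_ennreal by (rule SUP_least)
  with A(2) \<open>0 < c\<close> show False
    by (simp add: ennreal_SUP_of_nat_eq_top ennreal_top_mult split: if_splits)
qed

lemma vimage_translate_singleton:
  fixes x :: "'a::group_add"
  shows "(\<lambda>y. - x + y) -` {0} = {x}"
  by (auto simp: neg_eq_iff_add_eq_0[symmetric])

lemma open_singleton_0_imp_discrete:
  assumes "open {0::'a::topological_group_add}"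
  shows "(euclidean :: 'a topology) = discrete_topology UNIV"
proof -
  have "open ((\<lambda>y. - x + y) -` {0})" for x :: 'a
    using assms by (intro open_vimage continuous_intros)
  then have "open {x}" for x :: 'a
    unfolding vimage_translate_singleton .
  then show ?thesis
    using discrete_topology_unique[of UNIV "euclidean :: 'a topology"] by simp
qed

context haar_measure
begin

lemma emeasure_singleton_0:
  assumes "(euclidean :: 'a topology) \<noteq> discrete_topology UNIV"
  shows "emeasure \<mu> {0} = 0"
proof (rule ccontr)
  assume "emeasure \<mu> {0} \<noteq> 0"
  obtain F :: "'a set" where F: "open F" "0 \<in> F" "emeasure \<mu> F < \<infinity>"
    by (rule ex_open_nbhd_finite_measure)
  have "finite F"
  proof (rule finite_if_emeasure_singleton_ge)
    show "0 < emeasure \<mu> {0}" using \<open>emeasure \<mu> {0} \<noteq> 0\<close> by (simp add: zero_less_iff_neq_zero)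
    show "emeasure \<mu> {0} \<le> emeasure \<mu> {x}" for x
      using emeasure_vimage_translate[of "{0}" "- x"] by (simp add: vimage_translate_singleton)
  qed (use F in \<open>auto simp: sets_borel\<close>)
  then have "open (F - (F - {0}))"
    using F by (intro open_Diff finite_imp_closed) auto
  moreover have "F - (F - {0}) = {0}" using F by auto
  ultimately have "open {0::'a}" by simp
  from open_singleton_0_imp_discrete[OF this] assms show False by contradiction
qed

lemma ex_small_compact:
  assumes "emeasure \<mu> {0} = 0" "0 < \<epsilon>"
  shows "\<exists>V. compact V \<and> 0 < measure \<mu> V \<and> measure \<mu> V < \<epsilon>"
proof -
  have "emeasure \<mu> {0} < ennreal \<epsilon>" using assms by simp
  then obtain U where U: "open U" "{0} \<subseteq> U" "emeasure \<mu> U < ennreal \<epsilon>"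
    by (rule ex_open_superset_emeasure_less[rotated]) simp_all
  then have "0 < emeasure \<mu> U" by (intro emeasure_open_pos) auto
  then obtain V where V: "compact V" "V \<subseteq> U" "0 < emeasure \<mu> V"
    by (rule ex_compact_subset_emeasure_gt[OF U(1)])
  have "emeasure \<mu> V \<le> emeasure \<mu> U" using V U by (intro emeasure_mono open_sets)
  then have "emeasure \<mu> V < ennreal \<epsilon>" using U(3) by simp
  moreover have "emeasure \<mu> V = ennreal (measure \<mu> V)"
    using emeasure_compact[OF V(1)] by (intro emeasure_eq_ennreal_measure) auto
  ultimately show ?thesis using V by (intro exI[of _ V]) (simp add: ennreal_less_iff)
qed

lemma ex_vanishing_compact_sequence:
  assumes "(euclidean :: 'a topology) \<noteq> discrete_topology UNIV"
  obtains V :: "nat \<Rightarrow> 'a set" where "\<And>n. compact (V n)" "\<And>n. 0 < measure \<mu> (V n)"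
    "(\<lambda>n. measure \<mu> (V n)) \<longlonglongrightarrow> 0"
proof -
  have "\<forall>n. \<exists>V. compact V \<and> 0 < measure \<mu> V \<and> measure \<mu> V < inverse (real (Suc n))"
    by (intro allI ex_small_compact emeasure_singleton_0 assms) simp
  from choice[OF this] obtain V where V: "\<And>n. compact (V n)" "\<And>n. 0 < measure \<mu> (V n)"
      "\<And>n. measure \<mu> (V n) < inverse (real (Suc n))"
    by blast
  have "(\<lambda>n. measure \<mu> (V n)) \<longlonglongrightarrow> 0"
    using V(2,3) by (intro tendsto_sandwich[OF _ _ tendsto_const LIMSEQ_inverse_real_of_nat])
      (auto intro!: always_eventually less_imp_le)
  with V(1,2) show thesis by (rule that)
qed

end

lemma unstableI:
  fixes M :: "('f, 'r, 'm) cstructure"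
  assumes "is_model L T M" "\<And>n. a n \<in> universe M" "\<And>m. b m \<in> universe M"
    and v: "\<And>n m. eval M ((\<lambda>_. undefined)(x := a n, y := b m)) \<phi> = v n m"
    and "\<And>n. (\<lambda>m. v n m) \<longlonglongrightarrow> k" "\<And>m. (\<lambda>n. v n m) \<longlonglongrightarrow> l" "k \<noteq> l"
  shows "unstable TYPE('m) L T x y \<phi>"
  unfolding unstable_def Let_def v using assms
  by (intro exI[of _ M] exI[of _ a] exI[of _ b] conjI exI[of _ "\<lambda>_. k"] exI[of _ "\<lambda>_. l"]
      exI[of _ k] exI[of _ l]) auto

theorem proposition4p25:
  fixes \<mu> :: "'a::{topological_group_add, t2_space} measure"
  assumes "locally_compact_space (euclidean :: 'a topology)"
    and "(euclidean :: 'a topology) \<noteq> discrete_topology UNIV"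
    and "left_haar_measure \<mu>"
  shows "unstable TYPE(('a \<Rightarrow> real) set) L_cnv (Th L_cnv (L1_structure \<mu>)) 0 1
           (Dist (Var 0) (Fn Convol [Var 0, Var 1]))"
proof -
  interpret haar_measure \<mu> by unfold_locales (rule assms(3))
  obtain V where V: "\<And>n. compact (V n)" "\<And>n. 0 < measure \<mu> (V n)" "(\<lambda>n. measure \<mu> (V n)) \<longlonglongrightarrow> 0"
    by (rule ex_vanishing_compact_sequence[OF assms(2)]) blast
  obtain U where U: "\<And>m. 0 < measure \<mu> (U m)" and approximate_unit:
      "\<And>n. (\<lambda>m. convolution_dist (average \<mu> (V n)) (average \<mu> (U m))) \<longlonglongrightarrow> 0"
    by (rule ex_approximate_unit_sequence[of V, OF V(1,2)]) blast
  have densities: "prob_density \<mu> (average \<mu> (V n))" "prob_density \<mu> (average \<mu> (U m))" for n m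
    by (intro prob_density_average V U)+
  note unit = densities[THEN prob_density_in_L1_unit_functions]
  have bound: "average \<mu> (U m) x \<le> 1 / measure \<mu> (U m)" for m x
    by (simp add: average_def indicator_def)
  show ?thesis
  proof (rule unstableI[OF is_model_L1_structure _ _ eval_Dist_Convol[OF unit] approximate_unit
        convolution_dist_average_tendsto_2[OF V(2,3) densities(2) bound]])
    show "L1_class \<mu> (average \<mu> (V n)) \<in> universe (L1_structure \<mu>)"
      "L1_class \<mu> (average \<mu> (U n)) \<in> universe (L1_structure \<mu>)" for n
      unfolding L1_structure_simps by (intro L1_class_in_L1_ball unit)+
  qed simp
qed

end
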